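(* Let $1\leq q\leq r<\infty$ and let $\lambda,\mu,\nu,\alpha,\beta$ be real numbers. Then $H_{\lambda,\mu,\nu}$ is bounded from $L^q_\alpha$ to $L^r_\beta$ if and only if $$\lambda=\mu+\nu+1+\frac{\beta+1}{r}-\frac{\alpha+1}{q}\quad\text{and}\quad -r\nu<\beta+1<r(\lambda-\nu),$$ or equivalently, if and only if $$\lambda=\mu+\nu+1+\frac{\beta+1}{r}-\frac{\alpha+1}{q}\quad\text{and}\quad q(\mu+1-\lambda)<\alpha+1<q(\mu+1).$$
   Context: Let $p$ be a prime, $\mathbb{Q}_p$ the field of $p$-adic numbers with its norm $|\cdot|_p$ (so $|p|_p=p^{-1}$), $\mathbb{Q}_p^*=\mathbb{Q}_p\setminus\{0\}$, and $dx$ the Haar measure on $\mathbb{Q}_p$ normalized so that $\{x:|x|_p\leq 1\}$ has measure $1$. For $1\leq q<\infty$ and $\theta\in\mathbb{R}$, $L^q_\theta$ is the space of real-valued measurable functions $f$ on $\mathbb{Q}_p^*$ with $\|f\|_{q,\theta}=\left[\int_{\mathbb{Q}_p^*}|f(x)|^q|x|_p^\theta\,dx\right]^{1/q}<\infty$. For real $\lambda,\mu,\nu$ and a real-valued measurable $f$ on $\mathbb{Q}_p^*$, $$H_{\lambda,\mu,\nu}f(y)=\int_{\mathbb{Q}_p^*}\frac{|x|_p^\mu|y|_p^\nu}{[\max\{|x|_p,|y|_p\}]^\lambda}f(x)\,dx,\qquad y\in\mathbb{Q}_p^*.$$ "Bounded from $X$ to $Y$" means that for every $f\in X$ the integral converges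 absolutely for almost every $y$ and there is a constant $C$ with $\|H_{\lambda,\mu,\nu}f\|_Y\leq C\|f\|_X$ for all $f\in X$. *)

theory Defs
  imports "HOL-Analysis.Analysis" "Berlekamp_Zassenhaus.Finite_Field"
begin

definition padic_val :: "nat \<Rightarrow> rat \<Rightarrow> int" where
  "padic_val p x =
     int (multiplicity (int p) (fst (quotient_of x))) - int (multiplicity (int p) (snd (quotient_of x)))"

definition padic_abs :: "nat \<Rightarrow> rat \<Rightarrow> real" where
  "padic_abs p x = (if x = 0 then 0 else real p powi (- padic_val p x))"

lemma padic_val_frac:
  assumes p: "prime p" and "a \<noteq> 0" "b \<noteq> 0"
  shows "padic_val p (of_int a / of_int b) = int (multiplicity (int p) a) - int (multiplicity (int p) b)"
proof -
  obtain c d where cd: "quotient_of (of_int a / of_int b) = (c, d)"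
    by (cases "quotient_of (of_int a / of_int b)")
  have d: "d > 0" using quotient_of_denom_pos[OF cd] .
  have eq: "(of_int a / of_int b :: rat) = of_int c / of_int d" using quotient_of_div[OF cd] .
  then have "(of_int (a * d) :: rat) = of_int (c * b)"
    using assms d by (simp add: field_simps)
  then have e: "a * d = c * b" by (simp only: of_int_eq_iff)
  have c: "c \<noteq> 0" using e assms d by auto
  have pr: "prime_elem (int p)" using p by simp
  have "multiplicity (int p) (a * d) = multiplicity (int p) (c * b)" using e by simp
  then have "multiplicity (int p) a + multiplicity (int p) d = multiplicity (int p) c + multiplicity (int p) b"
    using prime_elem_multiplicity_mult_distrib[OF pr] assms d c by simp
  then show ?thesis unfolding padic_val_def cd by simp
qed

lemma rat_common_denom:
  fixes x y :: rat
  obtains a b c :: int where "x = of_int a / of_int c" "y = of_int b / of_int c" "c \<noteq> 0"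
proof -
  obtain a b where "quotient_of x = (a, b)" by (cases "quotient_of x")
  then have x: "x = of_int a / of_int b" "b > 0"
    using quotient_of_div quotient_of_denom_pos by auto
  obtain c d where "quotient_of y = (c, d)" by (cases "quotient_of y")
  then have y: "y = of_int c / of_int d" "d > 0"
    using quotient_of_div quotient_of_denom_pos by auto
  have "x = of_int (a * d) / of_int (b * d)" "y = of_int (c * b) / of_int (b * d)" "b * d \<noteq> 0"
    using x y by simp_all
  then show thesis by (rule that)
qed

lemma padic_abs_0 [simp]: "padic_abs p 0 = 0"
  by (simp add: padic_abs_def)

lemma padic_abs_nonneg [simp]: "padic_abs p x \<ge> 0"
  by (simp add: padic_abs_def)

lemma padic_abs_pos: "prime p \<Longrightarrow> x \<noteq> 0 \<Longrightarrow> padic_abs p x > 0"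
  using prime_gt_0_nat by (simp add: padic_abs_def)

lemma padic_abs_eq_0_iff: "prime p \<Longrightarrow> padic_abs p x = 0 \<longleftrightarrow> x = 0"
  using padic_abs_pos[of p x] by (metis less_irrefl padic_abs_0)

lemma padic_abs_1 [simp]: "prime p \<Longrightarrow> padic_abs p 1 = 1"
  using padic_val_frac[of p 1 1] by (simp add: padic_abs_def)

lemma padic_abs_self: "prime p \<Longrightarrow> padic_abs p (of_nat p) = 1 / real p"
  using padic_val_frac[of p "int p" 1] prime_gt_1_nat[of p]
  by (auto simp: padic_abs_def power_int_minus field_simps)

lemma padic_abs_mult:
  assumes p: "prime p" shows "padic_abs p (x * y) = padic_abs p x * padic_abs p y"
proof (cases "x = 0 \<or> y = 0")
  case False
  obtain a b c where xy: "x = of_int a / of_int c" "y = of_int b / of_int c" "c \<noteq> 0"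
    by (rule rat_common_denom)
  have nz: "a \<noteq> 0" "b \<noteq> 0" using False xy by auto
  have m: "x * y = of_int (a * b) / of_int (c * c)" using xy by simp
  have pr: "prime_elem (int p)" using p by simp
  have "padic_val p (x * y) = padic_val p x + padic_val p y"
    unfolding m unfolding xy
    using padic_val_frac[OF p, of "a * b" "c * c"] padic_val_frac[OF p nz(1) xy(3)]
      padic_val_frac[OF p nz(2) xy(3)] nz xy(3) prime_elem_multiplicity_mult_distrib[OF pr]
    by simp
  then show ?thesis
    using False p prime_gt_0_nat[of p] by (simp add: padic_abs_def power_int_add[symmetric] add.commute)
qed (auto simp: padic_abs_def)

lemma padic_abs_minus [simp]: "prime p \<Longrightarrow> padic_abs p (- x) = padic_abs p x"
proof -
  assume p: "prime p"
  have "padic_abs p (-1) = 1"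
    using padic_val_frac[of p "-1" 1] p multiplicity_unit_right[of "-1::int" "int p"]
    by (simp add: padic_abs_def)
  then show ?thesis using padic_abs_mult[OF p, of "-1" x] by simp
qed

lemma padic_abs_minus_commute: "prime p \<Longrightarrow> padic_abs p (x - y) = padic_abs p (y - x)"
  by (metis minus_diff_eq padic_abs_minus)

lemma padic_abs_ultra:
  assumes p: "prime p" shows "padic_abs p (x + y) \<le> max (padic_abs p x) (padic_abs p y)"
proof (cases "x = 0 \<or> y = 0 \<or> x + y = 0")
  case False
  obtain a b c where xy: "x = of_int a / of_int c" "y = of_int b / of_int c" "c \<noteq> 0"
    by (rule rat_common_denom)
  have nz: "a \<noteq> 0" "b \<noteq> 0" using False xy by auto
  have s: "x + y = of_int (a + b) / of_int c" using xy by (simp add: add_divide_distrib)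
  have sz: "a + b \<noteq> 0" using False s by auto
  define k where "k = min (multiplicity (int p) a) (multiplicity (int p) b)"
  have "int p ^ k dvd a" "int p ^ k dvd b"
    by (auto simp: k_def intro!: multiplicity_dvd')
  then have "int p ^ k dvd a + b" by simp
  then have "k \<le> multiplicity (int p) (a + b)"
    using p sz by (intro multiplicity_geI) (auto simp: prime_gt_1_nat)
  then have "padic_val p (x + y) \<ge> min (padic_val p x) (padic_val p y)"
    unfolding s unfolding xy
    using padic_val_frac[OF p sz xy(3)] padic_val_frac[OF p nz(1) xy(3)] padic_val_frac[OF p nz(2) xy(3)]
    by (auto simp: k_def)
  then have "- padic_val p (x + y) \<le> - padic_val p x \<or> - padic_val p (x + y) \<le> - padic_val p y"
    by linarith
  moreover have "real p \<ge> 1" using p prime_ge_1_nat by simp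
  ultimately have "real p powi (- padic_val p (x + y)) \<le> real p powi (- padic_val p x) \<or>
      real p powi (- padic_val p (x + y)) \<le> real p powi (- padic_val p y)"
    using power_int_increasing by blast
  then show ?thesis using False by (auto simp: padic_abs_def)
qed (auto simp: max.coboundedI1)

lemma padic_abs_triangle: "prime p \<Longrightarrow> padic_abs p (x + y) \<le> padic_abs p x + padic_abs p y"
  using padic_abs_ultra[of p x y] padic_abs_nonneg[of p x] padic_abs_nonneg[of p y] by linarith

lemma padic_abs_triangle3: "prime p \<Longrightarrow> \<bar>padic_abs p x - padic_abs p y\<bar> \<le> padic_abs p (x - y)"
  using padic_abs_triangle[of p "x - y" y] padic_abs_triangle[of p "y - x" x]
    padic_abs_minus_commute[of p x y] by auto

lemma padic_abs_inverse:
  assumes p: "prime p" shows "padic_abs p (inverse x) = inverse (padic_abs p x)"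
proof (cases "x = 0")
  case False
  then have "padic_abs p x * padic_abs p (inverse x) = 1"
    using padic_abs_mult[OF p, of x "inverse x"] p by simp
  then show ?thesis by (rule inverse_unique[symmetric])
qed auto

definition padic_cauchy :: "nat \<Rightarrow> (nat \<Rightarrow> rat) \<Rightarrow> bool" where
  "padic_cauchy p X \<longleftrightarrow> (\<forall>e>0. \<exists>N. \<forall>m\<ge>N. \<forall>n\<ge>N. padic_abs p (X m - X n) < e)"

definition padic_rel :: "nat \<Rightarrow> (nat \<Rightarrow> rat) \<Rightarrow> (nat \<Rightarrow> rat) \<Rightarrow> bool" where
  "padic_rel p X Y \<longleftrightarrow>
     padic_cauchy p X \<and> padic_cauchy p Y \<and> (\<lambda>n. padic_abs p (X n - Y n)) \<longlonglongrightarrow> 0"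

lemma padic_cauchy_const [simp]: "padic_cauchy p (\<lambda>_. c)"
  by (simp add: padic_cauchy_def)

lemma padic_cauchy_abs:
  assumes p: "prime p" and X: "padic_cauchy p X" shows "convergent (\<lambda>n. padic_abs p (X n))"
proof -
  have "Cauchy (\<lambda>n. padic_abs p (X n))"
    unfolding Cauchy_def dist_real_def
  proof (intro allI impI)
    fix e :: real assume "e > 0"
    then obtain N where N: "\<forall>m\<ge>N. \<forall>n\<ge>N. padic_abs p (X m - X n) < e"
      using X unfolding padic_cauchy_def by blast
    show "\<exists>M. \<forall>m\<ge>M. \<forall>n\<ge>M. \<bar>padic_abs p (X m) - padic_abs p (X n)\<bar> < e"
    proof (intro exI[of _ N] allI impI)
      fix m n assume "m \<ge> N" "n \<ge> N"
      then have "padic_abs p (X m - X n) < e" using N by blast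
      then show "\<bar>padic_abs p (X m) - padic_abs p (X n)\<bar> < e"
        using padic_abs_triangle3[OF p, of "X m" "X n"] by linarith
    qed
  qed
  then show ?thesis by (rule Cauchy_convergent)
qed

lemma padic_cauchy_bounded:
  assumes p: "prime p" and X: "padic_cauchy p X"
  obtains B where "B > 0" "\<And>n. padic_abs p (X n) \<le> B"
proof -
  have "Bseq (\<lambda>n. padic_abs p (X n))"
    using padic_cauchy_abs[OF assms] convergent_imp_Bseq by blast
  then obtain B where "B > 0" "\<And>n. norm (padic_abs p (X n)) \<le> B" by (auto elim: BseqE)
  then show thesis using that[of B] by simp
qed

lemma padic_cauchyI:
  assumes "\<And>e. e > 0 \<Longrightarrow> \<exists>N. \<forall>m\<ge>N. \<forall>n\<ge>N. padic_abs p (X m - X n) \<le> B * e" "B > 0"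
  shows "padic_cauchy p X"
  unfolding padic_cauchy_def
proof (intro allI impI)
  fix e :: real assume "e > 0"
  then have "e / (2 * B) > 0" using assms(2) by simp
  then obtain N where "\<forall>m\<ge>N. \<forall>n\<ge>N. padic_abs p (X m - X n) \<le> B * (e / (2 * B))"
    using assms(1) by blast
  moreover have "B * (e / (2 * B)) < e" using \<open>e > 0\<close> assms(2) by simp
  ultimately show "\<exists>N. \<forall>m\<ge>N. \<forall>n\<ge>N. padic_abs p (X m - X n) < e"
    by (meson order_le_less_trans)
qed

lemma padic_cauchy_add:
  assumes p: "prime p" and X: "padic_cauchy p X" and Y: "padic_cauchy p Y"
  shows "padic_cauchy p (\<lambda>n. X n + Y n)"
proof (rule padic_cauchyI[where B = 2])
  fix e :: real assume e: "e > 0"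
  obtain N1 where N1: "\<forall>m\<ge>N1. \<forall>n\<ge>N1. padic_abs p (X m - X n) < e"
    using X e unfolding padic_cauchy_def by blast
  obtain N2 where N2: "\<forall>m\<ge>N2. \<forall>n\<ge>N2. padic_abs p (Y m - Y n) < e"
    using Y e unfolding padic_cauchy_def by blast
  show "\<exists>N. \<forall>m\<ge>N. \<forall>n\<ge>N. padic_abs p (X m + Y m - (X n + Y n)) \<le> 2 * e"
  proof (intro exI[of _ "max N1 N2"] allI impI)
    fix m n assume mn: "m \<ge> max N1 N2" "n \<ge> max N1 N2"
    have *: "X m + Y m - (X n + Y n) = (X m - X n) + (Y m - Y n)" by simp
    show "padic_abs p (X m + Y m - (X n + Y n)) \<le> 2 * e"
      using padic_abs_triangle[OF p, of "X m - X n" "Y m - Y n"] N1[rule_format, of m n]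
        N2[rule_format, of m n] mn unfolding * by simp
  qed
qed simp

lemma padic_cauchy_uminus:
  assumes p: "prime p" and X: "padic_cauchy p X" shows "padic_cauchy p (\<lambda>n. - X n)"
  using X unfolding padic_cauchy_def
  by (metis (no_types, lifting) minus_diff_minus padic_abs_minus p)

lemma padic_cauchy_mult:
  assumes p: "prime p" and X: "padic_cauchy p X" and Y: "padic_cauchy p Y"
  shows "padic_cauchy p (\<lambda>n. X n * Y n)"
proof -
  obtain A where A: "A > 0" "\<And>n. padic_abs p (X n) \<le> A" using padic_cauchy_bounded[OF p X] by metis
  obtain B where B: "B > 0" "\<And>n. padic_abs p (Y n) \<le> B" using padic_cauchy_bounded[OF p Y] by metis
  show ?thesis
  proof (rule padic_cauchyI[where B = "A + B"])
    fix e :: real assume e: "e > 0"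
    obtain N1 where N1: "\<forall>m\<ge>N1. \<forall>n\<ge>N1. padic_abs p (X m - X n) < e"
      using X e unfolding padic_cauchy_def by blast
    obtain N2 where N2: "\<forall>m\<ge>N2. \<forall>n\<ge>N2. padic_abs p (Y m - Y n) < e"
      using Y e unfolding padic_cauchy_def by blast
    show "\<exists>N. \<forall>m\<ge>N. \<forall>n\<ge>N. padic_abs p (X m * Y m - X n * Y n) \<le> (A + B) * e"
    proof (intro exI[of _ "max N1 N2"] allI impI)
      fix m n assume mn: "m \<ge> max N1 N2" "n \<ge> max N1 N2"
      have "X m * Y m - X n * Y n = X m * (Y m - Y n) + (X m - X n) * Y n" by (simp add: algebra_simps)
      then have "padic_abs p (X m * Y m - X n * Y n) \<le>
        padic_abs p (X m) * padic_abs p (Y m - Y n) + padic_abs p (X m - X n) * padic_abs p (Y n)"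
        using padic_abs_triangle[OF p, of "X m * (Y m - Y n)" "(X m - X n) * Y n"]
        by (simp add: padic_abs_mult[OF p])
      also have "\<dots> \<le> A * e + e * B"
        using A B N1[rule_format, of m n] N2[rule_format, of m n] mn e
        by (intro add_mono mult_mono) auto
      finally show "padic_abs p (X m * Y m - X n * Y n) \<le> (A + B) * e" by (simp add: algebra_simps)
    qed
  qed (use A B in auto)
qed

lemma padic_cauchy_away:
  assumes p: "prime p" and X: "padic_cauchy p X" and nz: "\<not> (\<lambda>n. padic_abs p (X n)) \<longlonglongrightarrow> 0"
  obtains b N where "b > 0" "\<And>n. n \<ge> N \<Longrightarrow> padic_abs p (X n) > b"
proof -
  obtain L where L: "(\<lambda>n. padic_abs p (X n)) \<longlonglongrightarrow> L"
    using padic_cauchy_abs[OF p X] by (auto simp: convergent_def)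
  have "L \<ge> 0" by (rule LIMSEQ_le_const[OF L]) auto
  then have "L > 0" using nz L by (cases "L = 0") auto
  then have "eventually (\<lambda>n. padic_abs p (X n) > L / 2) sequentially"
    using order_tendstoD(1)[OF L, of "L/2"] by simp
  then show thesis using that[of "L/2"] \<open>L > 0\<close> by (auto simp: eventually_sequentially)
qed

lemma padic_cauchy_inverse:
  assumes p: "prime p" and X: "padic_cauchy p X" and nz: "\<not> (\<lambda>n. padic_abs p (X n)) \<longlonglongrightarrow> 0"
  shows "padic_cauchy p (\<lambda>n. inverse (X n))"
proof -
  obtain b N where b: "b > 0" "\<And>n. n \<ge> N \<Longrightarrow> padic_abs p (X n) > b"
    using padic_cauchy_away[OF assms] by metis
  show ?thesis
  proof (rule padic_cauchyI[where B = "inverse b * inverse b"])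
    fix e :: real assume e: "e > 0"
    obtain N1 where N1: "\<forall>m\<ge>N1. \<forall>n\<ge>N1. padic_abs p (X m - X n) < e"
      using X e unfolding padic_cauchy_def by blast
    show "\<exists>N. \<forall>m\<ge>N. \<forall>n\<ge>N. padic_abs p (inverse (X m) - inverse (X n)) \<le> inverse b * inverse b * e"
    proof (intro exI[of _ "max N N1"] allI impI)
      fix m n assume mn: "m \<ge> max N N1" "n \<ge> max N N1"
      have bm: "padic_abs p (X m) > b" "padic_abs p (X n) > b" using b mn by auto
      then have nz: "X m \<noteq> 0" "X n \<noteq> 0" using b by auto
      then have "inverse (X m) - inverse (X n) = inverse (X m) * inverse (X n) * (X n - X m)"
        by (simp add: field_simps)
      then have "padic_abs p (inverse (X m) - inverse (X n)) =
        inverse (padic_abs p (X m)) * inverse (padic_abs p (X n)) * padic_abs p (X n - X m)"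
        by (simp add: padic_abs_mult[OF p] padic_abs_inverse[OF p])
      also have "\<dots> \<le> inverse b * inverse b * e"
        using bm b(1) e N1[rule_format, of n m] mn
        by (intro mult_mono le_imp_inverse_le) auto
      finally show "padic_abs p (inverse (X m) - inverse (X n)) \<le> inverse b * inverse b * e" .
    qed
  qed (use b in auto)
qed

lemma padic_rel_sym: "prime p \<Longrightarrow> padic_rel p X Y \<Longrightarrow> padic_rel p Y X"
  unfolding padic_rel_def using padic_abs_minus_commute[of p] by auto

lemma padic_null_add:
  assumes p: "prime p" and "(\<lambda>n. padic_abs p (X n)) \<longlonglongrightarrow> 0" "(\<lambda>n. padic_abs p (Y n)) \<longlonglongrightarrow> 0"
  shows "(\<lambda>n. padic_abs p (X n + Y n)) \<longlonglongrightarrow> 0"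
  by (rule tendsto_sandwich[OF _ _ tendsto_const tendsto_add_zero[OF assms(2,3)]])
     (auto intro!: always_eventually padic_abs_triangle p)

lemma padic_null_mult:
  assumes p: "prime p" and X: "padic_cauchy p X" and "(\<lambda>n. padic_abs p (Y n)) \<longlonglongrightarrow> 0"
  shows "(\<lambda>n. padic_abs p (X n * Y n)) \<longlonglongrightarrow> 0"
proof -
  obtain L where L: "(\<lambda>n. padic_abs p (X n)) \<longlonglongrightarrow> L"
    using padic_cauchy_abs[OF p X] by (auto simp: convergent_def)
  show ?thesis using tendsto_mult[OF L assms(3)] by (simp add: padic_abs_mult[OF p])
qed

lemma padic_rel_trans:
  assumes p: "prime p" "padic_rel p X Y" "padic_rel p Y Z" shows "padic_rel p X Z"
  using padic_null_add[OF p(1), of "\<lambda>n. X n - Y n" "\<lambda>n. Y n - Z n"] p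
  by (auto simp: padic_rel_def)

lemma padic_rel_refl: "padic_cauchy p X \<Longrightarrow> padic_rel p X X"
  by (simp add: padic_rel_def)

lemma padic_rel_part_equivp: "prime p \<Longrightarrow> part_equivp (padic_rel p)"
  by (intro part_equivpI exI[of _ "\<lambda>_. 0"] padic_rel_refl sympI transpI)
     (auto intro: padic_rel_sym padic_rel_trans)

text \<open>
  \<open>'p padic\<close> is the completion of the rationals with respect to the \<open>p\<close>-adic absolute value,
  where \<open>p = CARD('p)\<close>.
\<close>

typedef ('p::prime_card) padic =
  "{{Y. padic_rel CARD('p) X Y} | X. padic_cauchy CARD('p) X}"
  by (auto intro: padic_cauchy_const)

definition abs_padic :: "(nat \<Rightarrow> rat) \<Rightarrow> 'p::prime_card padic" where
  "abs_padic X = Abs_padic {Y. padic_rel CARD('p) X Y}"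

definition rep_padic :: "'p::prime_card padic \<Rightarrow> nat \<Rightarrow> rat" where
  "rep_padic x = (SOME X. X \<in> Rep_padic x)"

definition cr_padic :: "(nat \<Rightarrow> rat) \<Rightarrow> 'p::prime_card padic \<Rightarrow> bool" where
  "cr_padic X x \<longleftrightarrow> padic_rel CARD('p) X X \<and> abs_padic X = x"

lemma Quotient_padic:
  "Quotient (padic_rel CARD('p::prime_card)) abs_padic rep_padic (cr_padic :: _ \<Rightarrow> 'p padic \<Rightarrow> bool)"
proof -
  let ?R = "padic_rel CARD('p)"
  have p: "prime CARD('p)" by (rule prime_card)
  have c: "?R X X \<longleftrightarrow> padic_cauchy CARD('p) X" for X by (auto simp: padic_rel_def)
  have Rep: "Rep_padic (abs_padic X :: 'p padic) = {Y. ?R X Y}" if "?R X X" for X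
    unfolding abs_padic_def using that c by (intro Abs_padic_inverse) auto
  have rep: "?R (rep_padic x) (rep_padic x) \<and> abs_padic (rep_padic x) = x" for x :: "'p padic"
  proof -
    obtain X where X: "Rep_padic x = {Y. ?R X Y}" "?R X X" using Rep_padic[of x] c by auto
    have "rep_padic x \<in> Rep_padic x" unfolding rep_padic_def by (rule someI[of _ X]) (use X in simp)
    then have r: "?R X (rep_padic x)" using X by simp
    then have "{Y. ?R (rep_padic x) Y} = {Y. ?R X Y}"
      using padic_rel_sym[OF p] padic_rel_trans[OF p] by blast
    then have "(abs_padic (rep_padic x) :: 'p padic) = Abs_padic (Rep_padic x)"
      unfolding abs_padic_def using X(1) by (simp only:)
    then have "abs_padic (rep_padic x) = x" by (simp only: Rep_padic_inverse)
    then show ?thesis using r by (simp add: padic_rel_def)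
  qed
  show ?thesis
  proof (rule QuotientI)
    show "abs_padic (rep_padic x) = x" "?R (rep_padic x) (rep_padic x)" for x :: "'p padic"
      using rep by auto
    show "?R X Y \<longleftrightarrow> ?R X X \<and> ?R Y Y \<and> (abs_padic X :: 'p padic) = abs_padic Y" for X Y
    proof
      assume XY: "?R X Y"
      then have "{Z. ?R X Z} = {Z. ?R Y Z}" using padic_rel_sym[OF p] padic_rel_trans[OF p] by blast
      then show "?R X X \<and> ?R Y Y \<and> (abs_padic X :: 'p padic) = abs_padic Y"
        using XY c by (simp add: abs_padic_def padic_rel_def)
    next
      assume "?R X X \<and> ?R Y Y \<and> (abs_padic X :: 'p padic) = abs_padic Y"
      then show "?R X Y" using Rep[of X] Rep[of Y] by auto
    qed
    show "cr_padic = (\<lambda>X (x :: 'p padic). ?R X X \<and> abs_padic X = x)"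
      by (intro ext) (simp add: cr_padic_def)
  qed
qed

setup_lifting Quotient_padic

lemma padic_null_cong:
  assumes "padic_rel CARD('p::prime_card) X Y"
  shows "(\<lambda>n. padic_abs CARD('p) (X n)) \<longlonglongrightarrow> 0 \<longleftrightarrow> (\<lambda>n. padic_abs CARD('p) (Y n)) \<longlonglongrightarrow> 0"
  using padic_null_add[OF prime_card[where 'a='p], of "\<lambda>n. X n - Y n" Y]
    padic_null_add[OF prime_card[where 'a='p], of "\<lambda>n. Y n - X n" X]
    assms padic_rel_sym[OF prime_card assms] by (auto simp: padic_rel_def)

lift_definition padic_inverse :: "'p::prime_card padic \<Rightarrow> 'p padic" is
  "\<lambda>X. if (\<lambda>n. padic_abs CARD('p) (X n)) \<longlonglongrightarrow> 0 then (\<lambda>_. 0) else (\<lambda>n. inverse (X n))"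
  subgoal premises rel for X Y
  proof -
    let ?p = "CARD('p)"
    have p: "prime ?p" by (rule prime_card)
    have XY: "padic_cauchy ?p X" "padic_cauchy ?p Y" "(\<lambda>n. padic_abs ?p (X n - Y n)) \<longlonglongrightarrow> 0"
      using rel by (auto simp: padic_rel_def)
    show ?thesis
    proof (cases "(\<lambda>n. padic_abs ?p (X n)) \<longlonglongrightarrow> 0")
      case True
      then show ?thesis using padic_null_cong[OF rel] by (simp add: padic_rel_refl)
    next
      case False
      then have F: "\<not> (\<lambda>n. padic_abs ?p (Y n)) \<longlonglongrightarrow> 0" using padic_null_cong[OF rel] by simp
      have iX: "padic_cauchy ?p (\<lambda>n. inverse (X n))" by (rule padic_cauchy_inverse[OF p XY(1) False])
      have iY: "padic_cauchy ?p (\<lambda>n. inverse (Y n))" by (rule padic_cauchy_inverse[OF p XY(2) F])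
      have lim: "(\<lambda>n. padic_abs ?p (- (inverse (X n) * inverse (Y n)) * (X n - Y n))) \<longlonglongrightarrow> 0"
        by (rule padic_null_mult[OF p padic_cauchy_uminus[OF p padic_cauchy_mult[OF p iX iY]] XY(3)])
      obtain b N where b: "b > 0" "\<And>n. n \<ge> N \<Longrightarrow> padic_abs ?p (X n) > b"
        using padic_cauchy_away[OF p XY(1) False] by metis
      obtain c M where c: "c > 0" "\<And>n. n \<ge> M \<Longrightarrow> padic_abs ?p (Y n) > c"
        using padic_cauchy_away[OF p XY(2) F] by metis
      have "eventually (\<lambda>n. - (inverse (X n) * inverse (Y n)) * (X n - Y n) = inverse (X n) - inverse (Y n)) sequentially"
        unfolding eventually_sequentially
      proof (intro exI[of _ "max N M"] allI impI)
        fix n assume "n \<ge> max N M"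
        then have "X n \<noteq> 0" "Y n \<noteq> 0" using b(1) c(1) b(2)[of n] c(2)[of n] by auto
        then show "- (inverse (X n) * inverse (Y n)) * (X n - Y n) = inverse (X n) - inverse (Y n)"
          by (simp add: field_simps)
      qed
      then have "eventually (\<lambda>n. padic_abs ?p (- (inverse (X n) * inverse (Y n)) * (X n - Y n)) =
          padic_abs ?p (inverse (X n) - inverse (Y n))) sequentially"
        by (rule eventually_mono) simp
      then have "(\<lambda>n. padic_abs ?p (inverse (X n) - inverse (Y n))) \<longlonglongrightarrow> 0"
        using lim by (rule Lim_transform_eventually[rotated])
      then show ?thesis using False F iX iY by (simp add: padic_rel_def)
    qed
  qed
  done

instantiation padic :: (prime_card) field
begin

lift_definition zero_padic :: "'a padic" is "\<lambda>_. 0" by (simp add: padic_rel_refl)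

lift_definition one_padic :: "'a padic" is "\<lambda>_. 1" by (simp add: padic_rel_refl)

lift_definition plus_padic :: "'a padic \<Rightarrow> 'a padic \<Rightarrow> 'a padic" is "\<lambda>X Y n. X n + Y n"
  subgoal for X X' Y Y'
    using padic_null_add[OF prime_card[where 'a='a], of "\<lambda>n. X n - X' n" "\<lambda>n. Y n - Y' n"]
    by (auto simp: padic_rel_def padic_cauchy_add prime_card algebra_simps)
  done

lift_definition uminus_padic :: "'a padic \<Rightarrow> 'a padic" is "\<lambda>X n. - X n"
  subgoal for X X'
    using padic_abs_minus_commute[OF prime_card[where 'a='a]]
    by (auto simp: padic_rel_def padic_cauchy_uminus prime_card)
  done

definition minus_padic :: "'a padic \<Rightarrow> 'a padic \<Rightarrow> 'a padic" where
  "minus_padic x y = x + (- y)"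

lift_definition times_padic :: "'a padic \<Rightarrow> 'a padic \<Rightarrow> 'a padic" is "\<lambda>X Y n. X n * Y n"
  subgoal for X X' Y Y'
    using padic_null_add[OF prime_card[where 'a='a], of "\<lambda>n. X n * (Y n - Y' n)" "\<lambda>n. Y' n * (X n - X' n)"]
      padic_null_mult[OF prime_card[where 'a='a], of X "\<lambda>n. Y n - Y' n"]
      padic_null_mult[OF prime_card[where 'a='a], of Y' "\<lambda>n. X n - X' n"]
    by (auto simp: padic_rel_def padic_cauchy_mult prime_card algebra_simps)
  done

definition inverse_padic :: "'a padic \<Rightarrow> 'a padic" where
  "inverse_padic x = padic_inverse x"

definition divide_padic :: "'a padic \<Rightarrow> 'a padic \<Rightarrow> 'a padic" where
  "divide_padic x y = x * padic_inverse y"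

instance
proof
  fix a b c :: "'a padic"
  have p: "prime CARD('a)" by (rule prime_card)
  note cl = padic_cauchy_add[OF p] padic_cauchy_mult[OF p] padic_cauchy_uminus[OF p]
  show "a + b + c = a + (b + c)"
    by transfer (auto simp: padic_rel_def cl add.assoc)
  show "a + b = b + a"
    by transfer (auto simp: padic_rel_def cl add.commute)
  show "0 + a = a"
    by transfer (auto simp: padic_rel_def)
  show "- a + a = 0"
    by transfer (auto simp: padic_rel_def)
  show "a - b = a + - b" by (simp add: minus_padic_def)
  show "a * b * c = a * (b * c)"
    by transfer (auto simp: padic_rel_def cl mult.assoc)
  show "a * b = b * a"
    by transfer (auto simp: padic_rel_def cl mult.commute)
  show "1 * a = a"
    by transfer (auto simp: padic_rel_def)
  show "(a + b) * c = a * c + b * c"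
    by transfer (auto simp: padic_rel_def cl distrib_right)
  show "(0::'a padic) \<noteq> 1"
    by transfer (auto simp: padic_rel_def p LIMSEQ_const_iff)
  show "inverse (0::'a padic) = 0"
    unfolding inverse_padic_def by transfer (auto simp: padic_rel_def)
  show "a div b = a * inverse b" by (simp add: divide_padic_def inverse_padic_def)
  show "a \<noteq> 0 \<Longrightarrow> inverse a * a = 1"
    unfolding inverse_padic_def
  proof transfer
    fix X :: "nat \<Rightarrow> rat"
    assume X: "padic_rel CARD('a) X X" and nz: "\<not> padic_rel CARD('a) X (\<lambda>_. 0)"
    have c: "padic_cauchy CARD('a) X" using X by (simp add: padic_rel_def)
    have F: "\<not> (\<lambda>n. padic_abs CARD('a) (X n)) \<longlonglongrightarrow> 0" using nz c by (simp add: padic_rel_def)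
    obtain b N where b: "b > 0" "\<And>n. n \<ge> N \<Longrightarrow> padic_abs CARD('a) (X n) > b"
      using padic_cauchy_away[OF p c F] by metis
    have "eventually (\<lambda>n. padic_abs CARD('a) (inverse (X n) * X n - 1) = 0) sequentially"
      unfolding eventually_sequentially
    proof (intro exI[of _ N] allI impI)
      fix n assume "n \<ge> N"
      then have "X n \<noteq> 0" using b(1) b(2)[of n] by auto
      then show "padic_abs CARD('a) (inverse (X n) * X n - 1) = 0" by simp
    qed
    then have "(\<lambda>n. padic_abs CARD('a) (inverse (X n) * X n - 1)) \<longlonglongrightarrow> 0"
      by (rule tendsto_eventually)
    then show "padic_rel CARD('a) (\<lambda>n. (if (\<lambda>n. padic_abs CARD('a) (X n)) \<longlonglongrightarrow> 0 then \<lambda>_. 0 else (\<lambda>n. inverse (X n))) n * X n) (\<lambda>_. 1)"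
      using F c cl padic_cauchy_inverse[OF p c F] by (simp add: padic_rel_def)
  qed
qed

end

lift_definition padic_norm :: "'p::prime_card padic \<Rightarrow> real" is "\<lambda>X. lim (\<lambda>n. padic_abs CARD('p) (X n))"
  subgoal premises rel for X Y
  proof -
    have p: "prime CARD('p)" by (rule prime_card)
    obtain L where L: "(\<lambda>n. padic_abs CARD('p) (X n)) \<longlonglongrightarrow> L"
      using rel padic_cauchy_abs[OF p] by (auto simp: convergent_def padic_rel_def)
    have "(\<lambda>n. padic_abs CARD('p) (X n) - padic_abs CARD('p) (Y n)) \<longlonglongrightarrow> 0"
      by (rule tendsto_rabs_zero_cancel,
          rule tendsto_sandwich[of "\<lambda>_. 0" _ _ "\<lambda>n. padic_abs CARD('p) (X n - Y n)"])
         (use rel padic_abs_triangle3[OF p] in \<open>auto simp: padic_rel_def intro!: always_eventually\<close>)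
    from tendsto_diff[OF L this] have "(\<lambda>n. padic_abs CARD('p) (Y n)) \<longlonglongrightarrow> L" by simp
    then show ?thesis using L by (simp add: limI)
  qed
  done

instantiation padic :: (prime_card) metric_space
begin

definition dist_padic :: "'a padic \<Rightarrow> 'a padic \<Rightarrow> real" where
  "dist_padic x y = padic_norm (x - y)"

definition uniformity_padic :: "('a padic \<times> 'a padic) filter" where
  "uniformity_padic = (INF e\<in>{0 <..}. principal {(x, y). dist x y < e})"

definition open_padic :: "'a padic set \<Rightarrow> bool" where
  "open_padic U \<longleftrightarrow> (\<forall>x\<in>U. eventually (\<lambda>(x', y). x' = x \<longrightarrow> y \<in> U) uniformity)"

lemma padic_abs_LIM:
  "padic_rel CARD('a) X X \<Longrightarrow> (\<lambda>n. padic_abs CARD('a) (X n)) \<longlonglongrightarrow> lim (\<lambda>n. padic_abs CARD('a) (X n))"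
  using padic_cauchy_abs[OF prime_card[where 'a='a]]
  by (simp add: padic_rel_def convergent_LIMSEQ_iff)

lemma padic_norm_eq_0_iff: "padic_norm (x :: 'a padic) = 0 \<longleftrightarrow> x = 0"
proof transfer
  fix X assume X: "padic_rel CARD('a) X X"
  have "padic_rel CARD('a) X (\<lambda>_. 0) \<longleftrightarrow> (\<lambda>n. padic_abs CARD('a) (X n)) \<longlonglongrightarrow> 0"
    using X by (simp add: padic_rel_def)
  then show "lim (\<lambda>n. padic_abs CARD('a) (X n)) = 0 \<longleftrightarrow> padic_rel CARD('a) X (\<lambda>_. 0)"
    using padic_abs_LIM[OF X] limI by metis
qed

lemma padic_norm_ultra: "padic_norm (x + y :: 'a padic) \<le> max (padic_norm x) (padic_norm y)"
proof transfer
  fix X Y assume XY: "padic_rel CARD('a) X X" "padic_rel CARD('a) Y Y"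
  have "padic_rel CARD('a) (\<lambda>n. X n + Y n) (\<lambda>n. X n + Y n)"
    using XY by (auto simp: padic_rel_def padic_cauchy_add prime_card)
  from padic_abs_LIM[OF this] tendsto_max[OF padic_abs_LIM[OF XY(1)] padic_abs_LIM[OF XY(2)]]
  show "lim (\<lambda>n. padic_abs CARD('a) (X n + Y n)) \<le>
    max (lim (\<lambda>n. padic_abs CARD('a) (X n))) (lim (\<lambda>n. padic_abs CARD('a) (Y n)))"
    by (rule LIMSEQ_le) (use padic_abs_ultra[OF prime_card[where 'a='a]] in auto)
qed

lemma padic_norm_nonneg: "padic_norm (x :: 'a padic) \<ge> 0"
proof transfer
  fix X assume "padic_rel CARD('a) X X"
  from padic_abs_LIM[OF this] show "0 \<le> lim (\<lambda>n. padic_abs CARD('a) (X n))"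
    by (rule LIMSEQ_le_const) auto
qed

lemma padic_norm_minus: "padic_norm (- x :: 'a padic) = padic_norm x"
  by transfer (simp add: prime_card)

instance
proof
  fix x y z :: "'a padic"
  show "dist x y = 0 \<longleftrightarrow> x = y" by (simp add: dist_padic_def padic_norm_eq_0_iff)
  have "padic_norm (x - y) \<le> max (padic_norm (x - z)) (padic_norm (- (y - z)))"
    using padic_norm_ultra[of "x - z" "- (y - z)"] by simp
  then show "dist x y \<le> dist x z + dist y z"
    using padic_norm_nonneg[of "x - z"] padic_norm_nonneg[of "y - z"]
    unfolding dist_padic_def padic_norm_minus by linarith
qed (simp_all add: uniformity_padic_def open_padic_def)

end

lemma padic_norm_mult: "padic_norm (x * y :: 'p::prime_card padic) = padic_norm x * padic_norm y"
proof transfer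
  fix X Y assume XY: "padic_rel CARD('p) X X" "padic_rel CARD('p) Y Y"
  show "lim (\<lambda>n. padic_abs CARD('p) (X n * Y n)) =
    lim (\<lambda>n. padic_abs CARD('p) (X n)) * lim (\<lambda>n. padic_abs CARD('p) (Y n))"
    unfolding padic_abs_mult[OF prime_card[where 'a='p]]
    by (rule limI, rule tendsto_mult[OF padic_abs_LIM[OF XY(1)] padic_abs_LIM[OF XY(2)]])
qed

lemma padic_of_nat_rep: "of_nat k = (abs_padic (\<lambda>_. of_nat k) :: 'p::prime_card padic)"
proof (induction k)
  case (Suc k)
  show ?case unfolding of_nat_Suc Suc
    by (simp add: one_padic_def plus_padic.abs_eq padic_rel_refl eq_onp_same_args)
qed (simp add: zero_padic_def)

lemma padic_norm_const: "padic_norm (abs_padic (\<lambda>_. c) :: 'p::prime_card padic) = padic_abs CARD('p) c"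
  by (simp add: padic_norm.abs_eq padic_rel_refl)

lemma padic_norm_prime: "padic_norm (of_nat CARD('p) :: 'p::prime_card padic) = 1 / real CARD('p)"
  unfolding padic_of_nat_rep padic_norm_const by (simp add: padic_abs_self prime_card)

instance padic :: (prime_card) field_char_0
proof
  have "m = n" if "(of_nat m :: 'a padic) = of_nat n" for m n
  proof -
    have "padic_rel CARD('a) (\<lambda>_. of_nat m) (\<lambda>_. of_nat n)"
      by (rule iffD1[OF Quotient_rel[OF Quotient_padic[where 'p='a]]])
         (use that in \<open>simp add: padic_of_nat_rep padic_rel_refl\<close>)
    then show ?thesis by (simp add: padic_rel_def LIMSEQ_const_iff padic_abs_eq_0_iff prime_card)
  qed
  then show "inj (of_nat :: nat \<Rightarrow> 'a padic)" by (auto intro: injI)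
qed

lemma padic_of_rat_rep: "of_rat c = (abs_padic (\<lambda>_. c) :: 'p::prime_card padic)"
proof -
  have int: "of_int k = (abs_padic (\<lambda>_. of_int k) :: 'p padic)" for k
    by (cases k rule: int_cases2) (simp_all add: padic_of_nat_rep uminus_padic.abs_eq padic_rel_refl)
  obtain a b where "quotient_of c = (a, b)" by (cases "quotient_of c")
  then have c: "c = of_int a / of_int b" "b > 0"
    using quotient_of_div quotient_of_denom_pos by auto
  have "(abs_padic (\<lambda>_. c) :: 'p padic) * of_int b = of_int a"
    unfolding int using c by (simp add: times_padic.abs_eq padic_rel_refl)
  then have "(abs_padic (\<lambda>_. c) :: 'p padic) = of_int a / of_int b"
    using c(2) by (simp add: nonzero_eq_divide_eq)
  also have "\<dots> = of_rat c" by (simp add: c(1) of_rat_divide)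
  finally show ?thesis by simp
qed

lemma padic_norm_of_rat: "padic_norm (of_rat c :: 'p::prime_card padic) = padic_abs CARD('p) c"
  by (simp add: padic_of_rat_rep padic_norm_const)

lemma padic_tendsto_rep:
  assumes "padic_cauchy CARD('p::prime_card) X"
  shows "(\<lambda>n. of_rat (X n)) \<longlonglongrightarrow> (abs_padic X :: 'p padic)"
proof (rule metric_LIMSEQ_I)
  let ?p = "CARD('p)"
  fix e :: real assume e: "e > 0"
  obtain N where N: "\<forall>m\<ge>N. \<forall>n\<ge>N. padic_abs ?p (X m - X n) < e / 2"
    using assms e unfolding padic_cauchy_def by (meson half_gt_zero)
  show "\<exists>N. \<forall>n\<ge>N. dist (of_rat (X n)) (abs_padic X :: 'p padic) < e"
  proof (intro exI[of _ N] allI impI)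
    fix n assume n: "n \<ge> N"
    have c: "padic_cauchy ?p (\<lambda>m. X n + - X m)"
      by (intro padic_cauchy_add padic_cauchy_uminus assms padic_cauchy_const prime_card)
    then have rel: "padic_rel ?p (\<lambda>m. X n - X m) (\<lambda>m. X n - X m)"
      by (simp add: padic_rel_refl)
    have "of_rat (X n) - abs_padic X = (abs_padic (\<lambda>m. X n - X m) :: 'p padic)"
      using assms by (simp add: padic_of_rat_rep minus_padic_def uminus_padic.abs_eq plus_padic.abs_eq
          padic_rel_refl padic_cauchy_uminus prime_card)
    then have "dist (of_rat (X n)) (abs_padic X :: 'p padic) = lim (\<lambda>m. padic_abs ?p (X n - X m))"
      using rel by (simp add: dist_padic_def padic_norm.abs_eq)
    also have "\<dots> \<le> e / 2"
      by (rule LIMSEQ_le_const2[OF padic_abs_LIM[OF rel]]) (use N n in \<open>auto intro!: exI[of _ N] less_imp_le\<close>)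
    finally show "dist (of_rat (X n)) (abs_padic X :: 'p padic) < e" using e by linarith
  qed
qed

lemma padic_rat_dense:
  fixes x :: "'p::prime_card padic"
  assumes "e > 0" obtains c where "dist (of_rat c) x < e"
proof -
  have "padic_rel CARD('p) (rep_padic x) (rep_padic x)" "abs_padic (rep_padic x) = x"
    using Quotient_padic by (auto simp: Quotient_def)
  then have "(\<lambda>n. of_rat (rep_padic x n)) \<longlonglongrightarrow> x"
    using padic_tendsto_rep[of "rep_padic x", where 'p='p] by (simp add: padic_rel_def)
  then obtain N where "\<forall>n\<ge>N. dist (of_rat (rep_padic x n)) x < e"
    using assms metric_LIMSEQ_D by blast
  then show thesis using that by blast
qed

instance padic :: (prime_card) complete_space
proof
  fix X :: "nat \<Rightarrow> 'a padic" assume X: "Cauchy X"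
  have "\<exists>c. dist (of_rat c) (X n) < inverse (real (Suc n))" for n
    by (rule padic_rat_dense[of "inverse (real (Suc n))" "X n"]) auto
  then obtain c where c: "\<And>n. dist (of_rat (c n)) (X n) < inverse (real (Suc n))" by metis
  have lim: "(\<lambda>n. dist (of_rat (c n)) (X n)) \<longlonglongrightarrow> 0"
    by (rule tendsto_sandwich[OF _ _ tendsto_const LIMSEQ_inverse_real_of_nat])
       (use c in \<open>auto intro!: always_eventually less_imp_le\<close>)
  have "padic_cauchy CARD('a) c"
    unfolding padic_cauchy_def
  proof (intro allI impI)
    fix e :: real assume "e > 0"
    then have e: "e / 3 > 0" by simp
    obtain N1 where N1: "\<forall>m\<ge>N1. \<forall>n\<ge>N1. dist (X m) (X n) < e / 3"
      using X e unfolding Cauchy_def by blast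
    obtain N2 where N2: "\<forall>n\<ge>N2. dist (of_rat (c n)) (X n) < e / 3"
      using order_tendstoD(2)[OF lim e] by (auto simp: eventually_sequentially)
    show "\<exists>N. \<forall>m\<ge>N. \<forall>n\<ge>N. padic_abs CARD('a) (c m - c n) < e"
    proof (intro exI[of _ "max N1 N2"] allI impI)
      fix m n assume mn: "m \<ge> max N1 N2" "n \<ge> max N1 N2"
      have "padic_abs CARD('a) (c m - c n) = dist (of_rat (c m) :: 'a padic) (of_rat (c n))"
        by (simp add: dist_padic_def padic_norm_of_rat flip: of_rat_diff)
      also have "\<dots> \<le> dist (of_rat (c m)) (X m) + dist (X m) (X n) + dist (of_rat (c n)) (X n)"
        using dist_triangle[of "of_rat (c m)" "of_rat (c n)" "X m"] dist_triangle[of "X m" "of_rat (c n)" "X n"]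
          dist_commute[of "X n" "of_rat (c n)"] by linarith
      also have "\<dots> < e"
        using N1[rule_format, of m n] N2[rule_format, of m] N2[rule_format, of n] mn by simp
      finally show "padic_abs CARD('a) (c m - c n) < e" .
    qed
  qed
  then have "(\<lambda>n. dist (of_rat (c n)) (abs_padic c :: 'a padic)) \<longlonglongrightarrow> 0"
    by (rule iffD1[OF tendsto_dist_iff padic_tendsto_rep])
  from tendsto_add[OF lim this]
  have "(\<lambda>n. dist (of_rat (c n)) (X n) + dist (of_rat (c n)) (abs_padic c :: 'a padic)) \<longlonglongrightarrow> 0" by simp
  then have "(\<lambda>n. dist (X n) (abs_padic c)) \<longlonglongrightarrow> 0"
    by (rule tendsto_sandwich[OF _ _ tendsto_const, rotated 2])
       (auto intro!: always_eventually dist_triangle3)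
  then have "X \<longlonglongrightarrow> abs_padic c" by (rule iffD2[OF tendsto_dist_iff])
  then show "convergent X" by (auto simp: convergent_def)
qed

text \<open>
  Translation invariance and the value on the unit ball determine the Haar measure on the Borel sets;
  finiteness on compact sets follows.
\<close>

definition normalized_haar :: "'p::prime_card padic measure \<Rightarrow> bool" where
  "normalized_haar M \<longleftrightarrow>
     sets M = sets borel \<and>
     (\<forall>a. \<forall>A \<in> sets borel. emeasure M ((\<lambda>x. a + x) ` A) = emeasure M A) \<and>
     emeasure M {x. padic_norm x \<le> 1} = 1"

text \<open>
  Functions on the nonzero \<open>p\<close>-adic numbers are represented by functions on \<open>'p padic\<close>;
  their value at \<open>0\<close> is irrelevant, because \<open>0\<close> is not in the space of \<open>punctured M\<close>.
\<close>

definition punctured :: "'p::prime_card padic measure \<Rightarrow> 'p padic measure" where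
  "punctured M = restrict_space M (- {0})"

definition Lspace :: "'p::prime_card padic measure \<Rightarrow> real \<Rightarrow> real \<Rightarrow> ('p padic \<Rightarrow> real) set" where
  "Lspace M q \<theta> =
     {f \<in> borel_measurable (punctured M).
        integrable (punctured M) (\<lambda>x. \<bar>f x\<bar> powr q * padic_norm x powr \<theta>)}"

definition Lnorm :: "'p::prime_card padic measure \<Rightarrow> real \<Rightarrow> real \<Rightarrow> ('p padic \<Rightarrow> real) \<Rightarrow> real" where
  "Lnorm M q \<theta> f = (\<integral>x. \<bar>f x\<bar> powr q * padic_norm x powr \<theta> \<partial>punctured M) powr (1 / q)"

definition hlp_kernel :: "real \<Rightarrow> real \<Rightarrow> real \<Rightarrow> 'p::prime_card padic \<Rightarrow> 'p padic \<Rightarrow> real" where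
  "hlp_kernel l \<mu> \<nu> x y =
     padic_norm x powr \<mu> * padic_norm y powr \<nu> / max (padic_norm x) (padic_norm y) powr l"

definition hlp_op ::
  "'p::prime_card padic measure \<Rightarrow> real \<Rightarrow> real \<Rightarrow> real \<Rightarrow> ('p padic \<Rightarrow> real) \<Rightarrow> 'p padic \<Rightarrow> real" where
  "hlp_op M l \<mu> \<nu> f y = (\<integral>x. hlp_kernel l \<mu> \<nu> x y * f x \<partial>punctured M)"

text \<open>
  The Bochner integral is \<open>0\<close> where the integrand is not integrable, so absolute convergence for
  almost every \<open>y\<close> is required separately. Finiteness of the target norm is expressed by
  membership in the target space.
\<close>

definition hlp_bounded ::
  "'p::prime_card padic measure \<Rightarrow> real \<Rightarrow> real \<Rightarrow> real \<Rightarrow> real \<Rightarrow> real \<Rightarrow> real \<Rightarrow> real \<Rightarrow> bool" where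
  "hlp_bounded M l \<mu> \<nu> q \<alpha> r \<beta> \<longleftrightarrow>
     (\<forall>f \<in> Lspace M q \<alpha>.
        AE y in punctured M. integrable (punctured M) (\<lambda>x. hlp_kernel l \<mu> \<nu> x y * f x)) \<and>
     (\<exists>C. \<forall>f \<in> Lspace M q \<alpha>.
        hlp_op M l \<mu> \<nu> f \<in> Lspace M r \<beta> \<and>
        Lnorm M r \<beta> (hlp_op M l \<mu> \<nu> f) \<le> C * Lnorm M q \<alpha> f)"

end

theory Submission
  imports Defs
begin

text \<open>
  Write \<open>s = \<mu> + 1 - (\<alpha> + 1) / q\<close> and \<open>t = \<nu> + (\<beta> + 1) / r\<close>. Under the conditions of the theorem
  \<open>l = s + t\<close> with \<open>s, t > 0\<close>, and in terms of the multiplicative Haar measure \<open>dx / |x|\<close> and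
  \<open>\<phi>(x) = |f(x)| |x|^((\<alpha> + 1) / q)\<close> the operator has the kernel
  \<open>K(x, y) = |x|^s |y|^t / max(|x|, |y|)^(s + t)\<close>. This kernel is at most \<open>1\<close>, and its integrals in
  either variable are bounded by some \<open>\<kappa>\<close>, because on the spheres \<open>|x| = p^i\<close>, \<open>|y| = p^j\<close> it decays
  like \<open>p^(- min s t |i - j|)\<close>. By Jensen's inequality
  \<open>(\<integral> K \<phi>)^q \<le> \<kappa>^(q - 1) W\<close> with \<open>W = \<integral> K \<phi>^q \<le> A = \<integral> \<phi>^q\<close>, so the \<open>r\<close>-th power of \<open>\<integral> K \<phi>\<close>
  is at most a constant times \<open>A^(r / q - 1) W\<close>, and Tonelli's theorem gives \<open>\<integral> W \<le> \<kappa> A\<close>.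

  Conversely, testing on the indicators of all spheres \<open>|x| = p^k\<close> forces the value of \<open>l\<close>, and the
  image of the indicator of the unit sphere has finite norm only if the strict inequalities hold.
\<close>

section \<open>The p-adic norm\<close>

lemma prime_card_real_gt_1: "real CARD('p::prime_card) > 1"
  using prime_gt_1_nat[OF prime_card[where 'a='p]] by simp

section \<open>Norms of integers\<close>

lemma padic_norm_of_int_le_1: "padic_norm (of_int a :: 'p::prime_card padic) \<le> 1"
proof -
  have p: "prime CARD('p)" by (rule prime_card)
  have "padic_norm (of_int a :: 'p padic) = padic_abs CARD('p) (of_int a)"
    using padic_norm_of_rat[of "of_int a", where 'p='p] by simp
  also have "\<dots> \<le> 1"
  proof (cases "a = 0")
    case False
    then show ?thesis
      using padic_val_frac[OF p, of a 1] prime_gt_1_nat[OF p]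
      by (simp add: padic_abs_def power_int_le_one power_int_minus field_simps)
  qed simp
  finally show ?thesis .
qed

lemma padic_norm_of_int_eq_1:
  assumes "\<not> int CARD('p) dvd a"
  shows "padic_norm (of_int a :: 'p::prime_card padic) = 1"
proof -
  have p: "prime CARD('p)" by (rule prime_card)
  have "padic_norm (of_int a :: 'p padic) = padic_abs CARD('p) (of_int a)"
    using padic_norm_of_rat[of "of_int a", where 'p='p] by simp
  moreover have "a \<noteq> 0" using assms by auto
  ultimately show ?thesis
    using padic_val_frac[OF p, of a 1] assms
    by (simp add: padic_abs_def not_dvd_imp_multiplicity_0)
qed

lemma padic_norm_of_int_less_1:
  assumes "int CARD('p) dvd a"
  shows "padic_norm (of_int a :: 'p::prime_card padic) < 1"
proof -
  obtain b where b: "a = int CARD('p) * b" using assms by blast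
  have p1: "real CARD('p) > 1" by (rule prime_card_real_gt_1)
  have "padic_norm (of_int a :: 'p padic) = 1 / real CARD('p) * padic_norm (of_int b :: 'p padic)"
    unfolding b by (simp add: padic_norm_mult padic_norm_prime)
  also have "\<dots> \<le> 1 / real CARD('p) * 1"
    by (intro mult_left_mono padic_norm_of_int_le_1) simp
  also have "\<dots> < 1" using p1 by simp
  finally show ?thesis .
qed

section \<open>The norm as a continuous ultrametric absolute value with discrete values\<close>

lemma padic_norm_1 [simp]: "padic_norm (1 :: 'p::prime_card padic) = 1"
  using padic_norm_of_rat[of 1, where 'p='p] by (simp add: prime_card)

lemma padic_norm_0 [simp]: "padic_norm (0 :: 'p::prime_card padic) = 0"
  by (simp add: padic_norm_eq_0_iff)

lemma padic_norm_pos: "x \<noteq> 0 \<Longrightarrow> padic_norm (x :: 'p::prime_card padic) > 0"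
  using padic_norm_nonneg[of x] padic_norm_eq_0_iff[of x] by linarith

lemma padic_norm_inverse: "padic_norm (inverse x :: 'p::prime_card padic) = inverse (padic_norm x)"
proof (cases "x = 0")
  case False
  then have "padic_norm x * padic_norm (inverse x) = 1"
    unfolding padic_norm_mult[symmetric] by simp
  then show ?thesis by (rule inverse_unique[symmetric])
qed simp

lemma padic_norm_divide: "padic_norm (x / y :: 'p::prime_card padic) = padic_norm x / padic_norm y"
  by (simp add: divide_inverse padic_norm_mult padic_norm_inverse)

lemma padic_norm_power: "padic_norm (x ^ n :: 'p::prime_card padic) = padic_norm x ^ n"
  by (induction n) (simp_all add: padic_norm_mult)

lemma padic_norm_triangle3:
  "\<bar>padic_norm x - padic_norm y\<bar> \<le> padic_norm (x - y :: 'p::prime_card padic)"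
proof -
  have "padic_norm x \<le> padic_norm (x - y) + padic_norm y" for x y :: "'p padic"
    using padic_norm_ultra[of "x - y" y] padic_norm_nonneg[of "x - y"] padic_norm_nonneg[of y] by simp
  from this[of x y] this[of y x] show ?thesis
    using padic_norm_minus[of "x - y"] by simp
qed

lemma continuous_on_padic_norm: "continuous_on UNIV (padic_norm :: 'p::prime_card padic \<Rightarrow> real)"
  unfolding continuous_on_iff
proof (intro ballI allI impI)
  fix x :: "'p padic" and e :: real assume "e > 0"
  then show "\<exists>d>0. \<forall>x'\<in>UNIV. dist x' x < d \<longrightarrow> dist (padic_norm x') (padic_norm x) < e"
    using padic_norm_triangle3[of _ x]
    by (intro exI[of _ e]) (auto simp: dist_padic_def dist_real_def intro: le_less_trans)
qed

lemma padic_norm_measurable [measurable]: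
  "(padic_norm :: 'p::prime_card padic \<Rightarrow> real) \<in> borel_measurable borel"
  by (rule borel_measurable_continuous_onI[OF continuous_on_padic_norm])

text \<open>The isosceles principle of ultrametric spaces: \<open>y\<close> is the sum of
  \<open>- (x - y)\<close> and \<open>x\<close>, and the first summand is too small to attain the
  maximum.\<close>

lemma padic_norm_eq_if_close:
  assumes "padic_norm (x - y) < padic_norm (y :: 'p::prime_card padic)"
  shows "padic_norm x = padic_norm y"
proof (rule antisym)
  show "padic_norm x \<le> padic_norm y"
    using padic_norm_ultra[of "x - y" y] assms by simp
  have "padic_norm y \<le> max (padic_norm (x - y)) (padic_norm x)"
    using padic_norm_ultra[of "- (x - y)" x] by (simp only: padic_norm_minus) simp
  then show "padic_norm y \<le> padic_norm x" using assms by simp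
qed

text \<open>Completion creates no new norm values: the rationals are dense, and a rational closer to
  \<open>x\<close> than \<open>padic_norm x\<close> has exactly the norm of
  \<open>x\<close>.\<close>

lemma padic_norm_value_group:
  assumes "x \<noteq> 0"
  obtains k :: int where "padic_norm (x :: 'p::prime_card padic) = real CARD('p) powr of_int k"
proof -
  have p0: "real CARD('p) > 0" by simp
  obtain c where c: "dist (of_rat c) x < padic_norm x"
    using padic_rat_dense[OF padic_norm_pos[OF assms]] .
  then have eq: "padic_norm x = padic_abs CARD('p) c"
    using padic_norm_eq_if_close[of "of_rat c" x] by (simp add: dist_padic_def padic_norm_of_rat)
  then have "c \<noteq> 0" using padic_norm_pos[OF assms] by auto
  then have "padic_norm x = real CARD('p) powr of_int (- padic_val CARD('p) c)"
    unfolding eq padic_abs_def by (simp add: powr_real_of_int' del: of_int_minus)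
  then show thesis by (rule that)
qed

lemma padic_norm_surj:
  obtains z where "padic_norm (z :: 'p::prime_card padic) = real CARD('p) powr of_int k"
proof (cases "k \<ge> 0")
  case True
  have "padic_norm (inverse (of_nat CARD('p)) ^ nat k :: 'p padic) = real CARD('p) powr of_int k"
    using True by (simp add: padic_norm_power padic_norm_inverse padic_norm_prime powr_real_of_int')
                  (simp add: power_int_def)
  then show thesis by (rule that)
next
  case False
  have "padic_norm (of_nat CARD('p) ^ nat (- k) :: 'p padic) = real CARD('p) powr of_int k"
    using False by (simp add: padic_norm_power padic_norm_prime powr_real_of_int')
                  (simp add: power_int_def field_simps)
  then show thesis by (rule that)
qed

text \<open>The residue field has p elements: a fraction a / b close to x has a denominator prime to
  p, so its class is that of a times an inverse of b modulo p.\<close>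

lemma padic_residue:
  assumes "padic_norm (x :: 'p::prime_card padic) \<le> 1"
  obtains i where "i < CARD('p)" "padic_norm (x - of_nat i) < 1"
proof -
  have p: "prime CARD('p)" by (rule prime_card)
  obtain c where c: "dist (of_rat c) x < 1"
    using padic_rat_dense[of 1 x] by auto
  have c1: "padic_norm (of_rat c :: 'p padic) \<le> 1"
    using padic_norm_ultra[of "of_rat c - x" x] c assms by (simp add: dist_padic_def)
  obtain a b where ab: "quotient_of c = (a, b)" by (cases "quotient_of c")
  have cab: "c = of_int a / of_int b" and b: "b > 0" and cop: "coprime a b"
    using quotient_of_div[OF ab] quotient_of_denom_pos[OF ab] quotient_of_coprime[OF ab] by auto
  have cb: "(of_rat c :: 'p padic) * of_int b = of_int a"
    using b by (simp add: cab of_rat_divide)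
  \<comment> \<open>If p divided b, then a = c b would have norm below 1, so p would divide a as
    well, although a / b is in lowest terms.\<close>
  have nb: "\<not> int CARD('p) dvd b"
  proof
    assume d: "int CARD('p) dvd b"
    have "padic_norm (of_int a :: 'p padic) \<le> 1 * padic_norm (of_int b :: 'p padic)"
      unfolding cb[symmetric] padic_norm_mult
      by (intro mult_right_mono c1 padic_norm_nonneg)
    also have "\<dots> < 1" using padic_norm_of_int_less_1[OF d] by simp
    finally have "int CARD('p) dvd a" using padic_norm_of_int_eq_1[of a, where 'p='p] by fastforce
    then have "int CARD('p) dvd 1" using d cop coprime_common_divisor by blast
    then show False using p by (simp add: prime_gt_1_nat)
  qed
  have "coprime b (int CARD('p))"
    using prime_imp_coprime[of "int CARD('p)" b] nb p by (simp add: coprime_commute)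
  then obtain u where u: "[b * u = 1] (mod int CARD('p))" using cong_solve_coprime_int by blast
  define i where "i = nat ((a * u) mod int CARD('p))"
  have p0: "int CARD('p) > 0" by simp
  have i: "int i = (a * u) mod int CARD('p)" "i < CARD('p)"
    unfolding i_def using p0 by (auto simp: nat_less_iff simp del: of_nat_0_less_iff)
  have "[b * int i = b * (a * u)] (mod int CARD('p))"
    unfolding i by (intro cong_mult) (simp_all add: cong_def)
  also have "[b * (a * u) = a * 1] (mod int CARD('p))"
    using cong_mult[OF cong_refl[of a] u] by (simp add: mult.left_commute)
  finally have "int CARD('p) dvd a - b * int i"
    by (metis cong_iff_dvd_diff cong_sym mult_1_right)
  \<comment> \<open>Clearing the denominator does not change the norm, since b has norm 1.\<close>
  from padic_norm_of_int_less_1[OF this]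
  have "padic_norm ((of_rat c - of_nat i) * of_int b :: 'p padic) < 1"
    by (simp add: left_diff_distrib cb mult.commute[of "of_int b" "of_nat i"])
  then have "padic_norm (of_rat c - of_nat i :: 'p padic) < 1"
    unfolding padic_norm_mult padic_norm_of_int_eq_1[OF nb] by simp
  then have "padic_norm (x - of_nat i) < 1"
    using padic_norm_ultra[of "- (of_rat c - x)" "of_rat c - of_nat i"] c
    unfolding padic_norm_minus by (simp add: dist_padic_def)
  then show thesis using i(2) that by blast
qed

section \<open>Balls and spheres\<close>

definition padic_ball :: "real \<Rightarrow> 'p::prime_card padic set" where
  "padic_ball r = {x. padic_norm x \<le> r}"

text \<open>Indexed by the exponent because every nonzero norm is an integral power of p, so these
  sets partition the nonzero elements.\<close>

definition padic_shell :: "int \<Rightarrow> 'p::prime_card padic set" where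
  "padic_shell k = {x. padic_norm x = real CARD('p) powr of_int k}"

lemma padic_ball_borel [measurable]: "padic_ball r \<in> sets borel"
  unfolding padic_ball_def by measurable

lemma padic_shell_borel [measurable]: "padic_shell k \<in> sets borel"
  unfolding padic_shell_def by measurable

text \<open>The value group is discrete: no norm lies strictly between p^(k - 1) and p^k.\<close>

lemma padic_norm_less_powr:
  assumes "padic_norm (x :: 'p::prime_card padic) < real CARD('p) powr of_int k"
  shows "padic_norm x \<le> real CARD('p) powr of_int (k - 1)"
proof (cases "x = 0")
  case False
  then obtain m :: int where m: "padic_norm x = real CARD('p) powr of_int m"
    by (rule padic_norm_value_group)
  have p1: "real CARD('p) > 1" by (rule prime_card_real_gt_1)
  have "m < k" using assms p1 unfolding m by simp
  then have "real_of_int m \<le> of_int (k - 1)" by linarith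
  then show ?thesis unfolding m using p1 by (intro powr_mono) auto
qed simp

text \<open>Division by \<open>z\<close> carries the larger ball to the unit ball, where
  \<open>padic_residue\<close> assigns a residue to each element. The translates are the cosets of
  the next smaller ball.\<close>

lemma padic_ball_partition:
  assumes z: "padic_norm (z :: 'p::prime_card padic) = real CARD('p) powr of_int k"
  shows "padic_ball (real CARD('p) powr of_int k) =
      (\<Union>i<CARD('p). (\<lambda>x. of_nat i * z + x) ` padic_ball (real CARD('p) powr of_int (k - 1)))"
    (is "?B = ?U")
    and "disjoint_family_on (\<lambda>i. (\<lambda>x. of_nat i * z + x) ` padic_ball (real CARD('p) powr of_int (k - 1))) {..<CARD('p)}"
proof -
  let ?p = "real CARD('p)"
  have p1: "?p > 1" by (rule prime_card_real_gt_1)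
  have z0: "z \<noteq> 0" using z by auto
  have lt: "?p powr of_int (k - 1) < ?p powr of_int k" using p1 by simp
  show "?B = ?U"
  proof (intro equalityI subsetI)
    fix x assume "x \<in> ?B"
    then have "padic_norm (x / z) \<le> 1"
      unfolding padic_norm_divide z using p1 by (simp add: padic_ball_def)
    then obtain i where i: "i < CARD('p)" "padic_norm (x / z - of_nat i) < 1"
      by (rule padic_residue)
    have "x - of_nat i * z = (x / z - of_nat i) * z" using z0 by (simp add: field_simps)
    then have "padic_norm (x - of_nat i * z) < ?p powr of_int k"
      using i(2) z p1 by (simp add: padic_norm_mult)
    then have "x - of_nat i * z \<in> padic_ball (?p powr of_int (k - 1))"
      unfolding padic_ball_def using padic_norm_less_powr by blast
    then have "x \<in> (\<lambda>x. of_nat i * z + x) ` padic_ball (?p powr of_int (k - 1))"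
      by (intro image_eqI[of _ _ "x - of_nat i * z"]) auto
    then show "x \<in> ?U" using i(1) by blast
  next
    fix x assume "x \<in> ?U"
    then obtain i y where x: "x = of_nat i * z + y" and y: "padic_norm y \<le> ?p powr of_int (k - 1)"
      by (auto simp: padic_ball_def)
    have "padic_norm (of_nat i * z) \<le> 1 * ?p powr of_int k"
      using padic_norm_of_int_le_1[of "int i", where 'p='p] z
      unfolding padic_norm_mult by (intro mult_mono) auto
    then show "x \<in> ?B"
      using padic_norm_ultra[of "of_nat i * z" y] y lt unfolding x padic_ball_def by simp
  qed
  show "disjoint_family_on (\<lambda>i. (\<lambda>x. of_nat i * z + x) ` padic_ball (?p powr of_int (k - 1))) {..<CARD('p)}"
    unfolding disjoint_family_on_def
  proof (intro ballI impI, rule ccontr)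
    fix i j assume ij: "i \<in> {..<CARD('p)}" "j \<in> {..<CARD('p)}" "i \<noteq> j"
    assume "(\<lambda>x. of_nat i * z + x) ` padic_ball (?p powr of_int (k - 1)) \<inter>
      (\<lambda>x. of_nat j * z + x) ` padic_ball (?p powr of_int (k - 1)) \<noteq> {}"
    then obtain x y where xy: "of_nat i * z + x = of_nat j * z + y"
      "padic_norm x \<le> ?p powr of_int (k - 1)" "padic_norm y \<le> ?p powr of_int (k - 1)"
      unfolding padic_ball_def by blast
    \<comment> \<open>Distinct numbers below p are incongruent, so (i - j) z has norm exactly p^k,
      while a difference of two elements of the smaller ball has norm at most p^(k - 1).\<close>
    have "\<not> int CARD('p) dvd int i - int j"
      using ij by (simp add: mod_eq_dvd_iff[symmetric] del: of_nat_diff)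
    then have "padic_norm (of_int (int i - int j) * z) = ?p powr of_int k"
      unfolding padic_norm_mult using padic_norm_of_int_eq_1[of "int i - int j", where 'p='p] z by simp
    moreover have "of_int (int i - int j) * z = y + (- x)"
      using xy(1) by (simp add: algebra_simps)
    ultimately show False
      using padic_norm_ultra[of y "- x"] xy(2,3) lt unfolding padic_norm_minus by auto
  qed
qed

section \<open>Haar measure of balls and spheres\<close>

locale padic_haar =
  fixes M :: "'p::prime_card padic measure"
  assumes haar: "normalized_haar M"
begin

lemma sets_haar [measurable_cong]: "sets M = sets borel"
  and emeasure_haar_translate: "A \<in> sets borel \<Longrightarrow> emeasure M ((\<lambda>x. a + x) ` A) = emeasure M A"
  and emeasure_haar_unit_ball: "emeasure M (padic_ball 1) = 1"
  using haar unfolding normalized_haar_def padic_ball_def by auto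

text \<open>A translate is the preimage under the continuous map
  \<open>\<lambda>x. x - a\<close>.\<close>

lemma translate_borel:
  assumes "A \<in> sets borel"
  shows "(\<lambda>x. a + x) ` A \<in> sets (borel :: 'p padic measure)"
proof -
  have "continuous_on UNIV (\<lambda>x :: 'p padic. x - a)"
    unfolding continuous_on_iff by (auto simp: dist_padic_def)
  then have m: "(\<lambda>x :: 'p padic. x - a) \<in> borel_measurable borel"
    by (rule borel_measurable_continuous_onI)
  have "(\<lambda>x. a + x) ` A = (\<lambda>x. x - a) -` A \<inter> space borel"
    by (auto intro: image_eqI[where x = "x - a" for x])
  then show ?thesis using measurable_sets[OF m assms] by simp
qed

lemma emeasure_haar_ball_step:
  "emeasure M (padic_ball (real CARD('p) powr of_int k)) =
     of_nat CARD('p) * emeasure M (padic_ball (real CARD('p) powr of_int (k - 1)))"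
proof -
  obtain z :: "'p padic" where z: "padic_norm z = real CARD('p) powr of_int k"
    by (rule padic_norm_surj)
  let ?A = "\<lambda>i. (\<lambda>x. of_nat i * z + x) ` padic_ball (real CARD('p) powr of_int (k - 1))"
  have "emeasure M (padic_ball (real CARD('p) powr of_int k)) = (\<Sum>i<CARD('p). emeasure M (?A i))"
    unfolding padic_ball_partition(1)[OF z]
    by (rule sum_emeasure[symmetric])
       (use padic_ball_partition(2)[OF z] in \<open>auto intro!: translate_borel simp: sets_haar\<close>)
  also have "\<dots> = of_nat CARD('p) * emeasure M (padic_ball (real CARD('p) powr of_int (k - 1)))"
    by (simp add: emeasure_haar_translate)
  finally show ?thesis .
qed

text \<open>The normalization settles k = 0; from there the recursion is followed upwards and, after
  cancelling the factor p, downwards.\<close>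

lemma emeasure_haar_ball: "emeasure M (padic_ball (real CARD('p) powr of_int k)) = ennreal (real CARD('p) powr of_int k)"
proof (induction k rule: int_induct[of _ 0])
  case base
  then show ?case by (simp add: emeasure_haar_unit_ball)
next
  case (step1 k)
  have "emeasure M (padic_ball (real CARD('p) powr of_int (k + 1))) = ennreal (real CARD('p)) * ennreal (real CARD('p) powr of_int k)"
    using emeasure_haar_ball_step[of "k + 1"] step1(2)
    by (simp add: ennreal_of_nat_eq_real_of_nat)
  then show ?case by (simp add: powr_add ennreal_mult[symmetric] mult.commute)
next
  case (step2 k)
  have "ennreal (real CARD('p)) * emeasure M (padic_ball (real CARD('p) powr of_int (k - 1))) = ennreal (real CARD('p) powr of_int k)"
    using emeasure_haar_ball_step[of k] step2(2) by (simp add: ennreal_of_nat_eq_real_of_nat)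
  also have "\<dots> = ennreal (real CARD('p)) * ennreal (real CARD('p) powr of_int (k - 1))"
    by (simp add: powr_diff ennreal_mult[symmetric])
  finally show ?case by (simp add: ennreal_mult_cancel_left)
qed

text \<open>By discreteness of the norm, a sphere is the difference of two consecutive
  balls.\<close>

lemma emeasure_haar_shell:
  "emeasure M (padic_shell k) = ennreal ((1 - 1 / real CARD('p)) * real CARD('p) powr of_int k)"
proof -
  have p1: "real CARD('p) > 1" by (rule prime_card_real_gt_1)
  have lt: "real CARD('p) powr of_int (k - 1) < real CARD('p) powr of_int k" using p1 by simp
  have "x \<in> padic_shell k \<longleftrightarrow>
      x \<in> padic_ball (real CARD('p) powr of_int k) - padic_ball (real CARD('p) powr of_int (k - 1))"
    for x :: "'p padic"
    unfolding padic_shell_def padic_ball_def using lt padic_norm_less_powr[of x k]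
    by (cases "padic_norm x < real CARD('p) powr of_int k") auto
  then have eq: "(padic_shell k :: 'p padic set) =
      padic_ball (real CARD('p) powr of_int k) - padic_ball (real CARD('p) powr of_int (k - 1))"
    by blast
  have sub: "padic_ball (real CARD('p) powr of_int (k - 1)) \<subseteq> (padic_ball (real CARD('p) powr of_int k) :: 'p padic set)"
    unfolding padic_ball_def using lt by (auto simp del: of_int_diff)
  have "emeasure M (padic_shell k) =
      emeasure M (padic_ball (real CARD('p) powr of_int k)) - emeasure M (padic_ball (real CARD('p) powr of_int (k - 1)))"
    unfolding eq by (rule emeasure_Diff) (use sub in \<open>simp_all add: sets_haar emeasure_haar_ball del: of_int_diff\<close>)
  also have "\<dots> = ennreal (real CARD('p) powr of_int k - real CARD('p) powr of_int (k - 1))"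
    unfolding emeasure_haar_ball by (rule ennreal_minus) simp
  also have "real CARD('p) powr of_int k - real CARD('p) powr of_int (k - 1) = (1 - 1 / real CARD('p)) * real CARD('p) powr of_int k"
    using p1 by (simp add: powr_diff algebra_simps)
  finally show ?thesis .
qed

section \<open>Integration over the nonzero elements\<close>

abbreviation P :: "'p padic measure" where "P \<equiv> punctured M"

lemma space_P: "space P = - {0}"
  using sets_eq_imp_space_eq[OF sets_haar] by (simp add: punctured_def space_restrict_space)

lemma punctured_measurable: "f \<in> measurable borel N \<Longrightarrow> f \<in> measurable P N"
  unfolding punctured_def
  by (rule measurable_restrict_space1) (simp add: measurable_cong_sets[OF sets_haar refl])

lemma padic_norm_measurable_P [measurable]: "padic_norm \<in> borel_measurable P"
  by (rule punctured_measurable) simp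

lemma padic_shell_nonzero: "padic_shell k \<subseteq> (- {0} :: 'p padic set)"
  by (auto simp: padic_shell_def)

lemma padic_shell_sets_P [measurable]: "padic_shell k \<in> sets P"
  unfolding punctured_def
  using padic_shell_nonzero[of k] sets_haar by (subst sets_restrict_space_iff) auto

lemma emeasure_P_shell: "emeasure P (padic_shell k) = ennreal ((1 - 1 / real CARD('p)) * real CARD('p) powr of_int k)"
  unfolding punctured_def
  using padic_shell_nonzero[of k] sets_haar
  by (subst emeasure_restrict_space) (auto simp: emeasure_haar_shell)

lemma Union_padic_shell: "(\<Union>k. padic_shell k) = space P"
  unfolding space_P
  by (auto simp: padic_shell_def elim: padic_norm_value_group)

lemma padic_shell_unique:
  assumes "(x :: 'p padic) \<in> padic_shell j"
  shows "x \<in> padic_shell k \<longleftrightarrow> j = k"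
  using assms prime_card_real_gt_1[where 'p='p] by (auto simp: padic_shell_def powr_inj)

lemma sigma_finite_P: "sigma_finite_measure P"
proof
  show "\<exists>A. countable A \<and> A \<subseteq> sets P \<and> \<Union> A = space P \<and> (\<forall>a\<in>A. emeasure P a \<noteq> \<infinity>)"
    by (rule exI[of _ "range padic_shell"]) (auto simp: Union_padic_shell emeasure_P_shell)
qed

text \<open>The norm is constant on each of the countably many spheres, so a radial integral is a
  sum of value times measure. The sum is an integral over counting measure on the integers, which
  allows shifts and reflections of the index.\<close>

lemma nn_integral_radial:
  assumes [measurable]: "g \<in> borel_measurable borel"
  shows "(\<integral>\<^sup>+x. g (padic_norm x) \<partial>P) =
    (\<integral>\<^sup>+k. g (real CARD('p) powr of_int k) * ennreal ((1 - 1 / real CARD('p)) * real CARD('p) powr of_int k) \<partial>count_space UNIV)"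
proof -
  have "(\<integral>\<^sup>+x. g (padic_norm x) \<partial>P) =
      (\<integral>\<^sup>+x. \<integral>\<^sup>+k. g (real CARD('p) powr of_int k) * indicator (padic_shell k) x \<partial>count_space UNIV \<partial>P)"
  proof (rule nn_integral_cong)
    fix x assume "x \<in> space P"
    then obtain j where j: "x \<in> padic_shell j" unfolding Union_padic_shell[symmetric] by blast
    have "(\<integral>\<^sup>+k. g (real CARD('p) powr of_int k) * indicator (padic_shell k) x \<partial>count_space UNIV) =
        (\<integral>\<^sup>+k. g (real CARD('p) powr of_int j) * indicator {j} k \<partial>count_space UNIV)"
      by (rule nn_integral_cong) (auto simp: padic_shell_unique[OF j] split: split_indicator)
    also have "\<dots> = g (padic_norm x)"
      using j by (simp add: nn_integral_cmult_indicator padic_shell_def)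
    finally show "g (padic_norm x) =
        (\<integral>\<^sup>+k. g (real CARD('p) powr of_int k) * indicator (padic_shell k) x \<partial>count_space UNIV)" by simp
  qed
  also have "\<dots> = (\<integral>\<^sup>+k. \<integral>\<^sup>+x. g (real CARD('p) powr of_int k) * indicator (padic_shell k) x \<partial>P \<partial>count_space UNIV)"
    by (rule nn_integral_count_space_nn_integral) auto
  also have "\<dots> = (\<integral>\<^sup>+k. g (real CARD('p) powr of_int k) * ennreal ((1 - 1 / real CARD('p)) * real CARD('p) powr of_int k) \<partial>count_space UNIV)"
    by (simp add: nn_integral_cmult_indicator emeasure_P_shell)
  finally show ?thesis .
qed

end

section \<open>Kernels with bounded marginals\<close>

text \<open>Convexity: the graph of u^q lies above its tangent at c. It follows from Young's
  inequality with weights 1 / q and 1 - 1 / q.\<close>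

lemma powr_tangent_le:
  fixes u c q :: real
  assumes "1 \<le> q" "0 \<le> u" "0 < c"
  shows "q * c powr (q - 1) * u \<le> u powr q + (q - 1) * c powr q"
proof (cases "u = 0")
  case False
  have "(u powr q) powr (1 / q) * (c powr q) powr (1 - 1 / q) \<le> 1 / q * u powr q + (1 - 1 / q) * c powr q"
    using assms False by (intro Youngs_inequality_0) auto
  moreover have "q * (1 - 1 / q) = q - 1" using assms by (simp add: field_simps)
  ultimately have "u * c powr (q - 1) \<le> 1 / q * u powr q + (1 - 1 / q) * c powr q"
    using assms False by (simp add: powr_powr)
  then have "q * (u * c powr (q - 1)) \<le> q * (1 / q * u powr q + (1 - 1 / q) * c powr q)"
    using assms by (intro mult_left_mono) auto
  also have "\<dots> = u powr q + (q - 1) * c powr q" using assms by (simp add: field_simps)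
  finally show ?thesis by (simp add: mult_ac)
qed (use assms in auto)

text \<open>Jensen's inequality for the density \<open>w\<close> of total mass at most \<kappa>,
  obtained by integrating the tangent inequality at a suitable point.\<close>

lemma weighted_jensen_powr:
  fixes w \<phi> :: "'a \<Rightarrow> real"
  assumes [measurable]: "w \<in> borel_measurable T" "\<phi> \<in> borel_measurable T"
    and w: "\<And>x. 0 \<le> w x" and \<phi>: "\<And>x. 0 \<le> \<phi> x" and q: "1 \<le> q" and \<kappa>: "0 < \<kappa>"
    and wi: "integrable T w" "(\<integral>x. w x \<partial>T) \<le> \<kappa>"
    and wq: "integrable T (\<lambda>x. w x * \<phi> x powr q)"
  shows "integrable T (\<lambda>x. w x * \<phi> x)"
    and "(\<integral>x. w x * \<phi> x \<partial>T) powr q \<le> \<kappa> powr (q - 1) * (\<integral>x. w x * \<phi> x powr q \<partial>T)"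
proof -
  have b: "q * c powr (q - 1) * (w x * \<phi> x) \<le> w x * \<phi> x powr q + (q - 1) * c powr q * w x" if "c > 0" for c x
    using mult_left_mono[OF powr_tangent_le[OF q \<phi>[of x] that] w[of x]] by (simp add: algebra_simps)
  show i: "integrable T (\<lambda>x. w x * \<phi> x)"
  proof (rule Bochner_Integration.integrable_bound)
    show "integrable T (\<lambda>x. w x * \<phi> x powr q + (q - 1) * w x)" using wi wq by simp
    show "AE x in T. norm (w x * \<phi> x) \<le> norm (w x * \<phi> x powr q + (q - 1) * w x)"
    proof (rule AE_I2)
      fix x
      have nn: "0 \<le> w x * \<phi> x" using w \<phi> by simp
      \<comment> \<open>Together with the tangent inequality at 1 this dominates w \<phi> by an
        integrable function.\<close>
      have "1 * (w x * \<phi> x) \<le> q * (w x * \<phi> x)" using q nn by (intro mult_right_mono) auto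
      then show "norm (w x * \<phi> x) \<le> norm (w x * \<phi> x powr q + (q - 1) * w x)"
        using b[of 1 x] nn by simp
    qed
  qed measurable
  define I where "I = (\<integral>x. w x * \<phi> x \<partial>T)"
  have I0: "I \<ge> 0" unfolding I_def using w \<phi> by simp
  show "I powr q \<le> \<kappa> powr (q - 1) * (\<integral>x. w x * \<phi> x powr q \<partial>T)"
  proof (cases "I = 0")
    case True
    then show ?thesis using w \<phi> by simp
  next
    case False
    \<comment> \<open>The point of tangency is the mean value of \<phi>, with \<kappa> in place of
      the mass. As I = c \<kappa>, the left side becomes q c^q \<kappa>, and subtracting (q - 1) c^q
      \<kappa> leaves c^q \<kappa>.\<close>
    define c where "c = I / \<kappa>"
    have c: "c > 0" "I = c * \<kappa>" using False I0 \<kappa> by (auto simp: c_def)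
    have "q * c powr (q - 1) * I = (\<integral>x. q * c powr (q - 1) * (w x * \<phi> x) \<partial>T)"
      unfolding I_def by simp
    also have "\<dots> \<le> (\<integral>x. w x * \<phi> x powr q + (q - 1) * c powr q * w x \<partial>T)"
      using i wi wq b[OF c(1)] by (intro integral_mono) auto
    also have "\<dots> = (\<integral>x. w x * \<phi> x powr q \<partial>T) + (q - 1) * c powr q * (\<integral>x. w x \<partial>T)"
      using wi wq by simp
    also have "\<dots> \<le> (\<integral>x. w x * \<phi> x powr q \<partial>T) + (q - 1) * c powr q * \<kappa>"
      using wi q by (intro add_left_mono mult_left_mono) auto
    finally have *: "q * c powr (q - 1) * I \<le> (\<integral>x. w x * \<phi> x powr q \<partial>T) + (q - 1) * c powr q * \<kappa>" .
    have "c powr q = c powr (q - 1) * c" using c powr_add[of c "q - 1" 1] by simp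
    then have "c powr q * \<kappa> \<le> (\<integral>x. w x * \<phi> x powr q \<partial>T)"
      using * unfolding c(2) by (simp add: algebra_simps)
    then have "\<kappa> powr (q - 1) * (c powr q * \<kappa>) \<le> \<kappa> powr (q - 1) * (\<integral>x. w x * \<phi> x powr q \<partial>T)"
      by (intro mult_left_mono) auto
    also have "\<kappa> powr (q - 1) * (c powr q * \<kappa>) = I powr q"
      unfolding c(2) using c(1) \<kappa> powr_add[of \<kappa> "q - 1" 1] by (simp add: powr_mult mult_ac)
    finally show ?thesis .
  qed
qed

text \<open>The marginal bound in x is the mass bound for Jensen's inequality, and the one in y is
  applied after Tonelli's theorem. The pointwise bound K \<le> 1 gives W \<le> A and thereby the
  gain from q to r.\<close>

lemma bounded_kernel_Lq_Lr:
  fixes K :: "'a \<Rightarrow> 'a \<Rightarrow> real" and \<phi> :: "'a \<Rightarrow> real"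
  assumes T: "sigma_finite_measure T"
    and K[measurable]: "case_prod K \<in> borel_measurable (T \<Otimes>\<^sub>M T)"
    and K0: "\<And>x y. 0 \<le> K x y" and K1: "\<And>x y. K x y \<le> 1"
    and Kx: "\<And>y. y \<in> space T \<Longrightarrow> (\<integral>\<^sup>+x. ennreal (K x y) \<partial>T) \<le> ennreal \<kappa>"
    and Ky: "\<And>x. x \<in> space T \<Longrightarrow> (\<integral>\<^sup>+y. ennreal (K x y) \<partial>T) \<le> ennreal \<kappa>"
    and \<kappa>: "0 < \<kappa>" and q: "1 \<le> q" "q \<le> r"
    and \<phi>[measurable]: "\<phi> \<in> borel_measurable T" and \<phi>0: "\<And>x. 0 \<le> \<phi> x"
    and \<phi>q: "integrable T (\<lambda>x. \<phi> x powr q)"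
  shows "y \<in> space T \<Longrightarrow> integrable T (\<lambda>x. K x y * \<phi> x)"
    and "integrable T (\<lambda>y. (\<integral>x. K x y * \<phi> x \<partial>T) powr r)"
    and "(\<integral>y. (\<integral>x. K x y * \<phi> x \<partial>T) powr r \<partial>T) \<le>
           \<kappa> powr ((q - 1) * (r / q) + 1) * (\<integral>x. \<phi> x powr q \<partial>T) powr (r / q)"
proof -
  interpret T: sigma_finite_measure T by (rule T)
  interpret TT: pair_sigma_finite T T ..
  define A where "A = (\<integral>x. \<phi> x powr q \<partial>T)"
  define W where "W y = (\<integral>x. K x y * \<phi> x powr q \<partial>T)" for y
  define \<psi> where "\<psi> y = (\<integral>x. K x y * \<phi> x \<partial>T)" for y
  have A0: "A \<ge> 0" unfolding A_def by simp
  have W0: "W y \<ge> 0" for y unfolding W_def using K0 by simp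
  have \<psi>0: "\<psi> y \<ge> 0" for y unfolding \<psi>_def using K0 \<phi>0 by simp
  have Km[measurable]: "(\<lambda>x. K x y) \<in> borel_measurable T" if "y \<in> space T" for y
    using measurable_Pair1'[OF that] measurable_compose[OF measurable_Pair2'[OF that] K] by simp
  have Wi: "integrable T (\<lambda>x. K x y * \<phi> x powr q)" if y: "y \<in> space T" for y
  proof (rule Bochner_Integration.integrable_bound[OF \<phi>q])
    show "AE x in T. norm (K x y * \<phi> x powr q) \<le> norm (\<phi> x powr q)"
      using K0 K1 by (auto intro!: mult_left_le_one_le)
  qed (use y in measurable)
  have WA: "W y \<le> A" if y: "y \<in> space T" for y
    unfolding W_def A_def using K0 K1 Wi[OF y] \<phi>q
    by (intro integral_mono) (auto intro!: mult_left_le_one_le)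
  have jensen: "integrable T (\<lambda>x. K x y * \<phi> x)" "\<psi> y powr q \<le> \<kappa> powr (q - 1) * W y" if y: "y \<in> space T" for y
  proof -
    have i: "integrable T (\<lambda>x. K x y)"
      using Kx[OF y] K0 y by (intro integrableI_bounded) (auto simp: le_less_trans)
    have le: "(\<integral>x. K x y \<partial>T) \<le> \<kappa>"
      using Kx[OF y] \<kappa> unfolding nn_integral_eq_integral[OF i AE_I2[OF K0]] by simp
    show "integrable T (\<lambda>x. K x y * \<phi> x)" "\<psi> y powr q \<le> \<kappa> powr (q - 1) * W y"
      unfolding \<psi>_def W_def using weighted_jensen_powr[OF Km[OF y] \<phi> K0 \<phi>0 q(1) \<kappa> i le Wi[OF y]] by auto
  qed
  show "y \<in> space T \<Longrightarrow> integrable T (\<lambda>x. K x y * \<phi> x)" by (rule jensen(1))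
  define D where "D = \<kappa> powr ((q - 1) * (r / q)) * A powr (r / q - 1)"
  have D0: "D \<ge> 0" unfolding D_def by simp
  have rq: "r / q \<ge> 1" using q by simp
  have pw: "\<psi> y powr r \<le> D * W y" if y: "y \<in> space T" for y
  proof -
    have "\<psi> y powr r = (\<psi> y powr q) powr (r / q)" using q by (simp add: powr_powr)
    also have "\<dots> \<le> (\<kappa> powr (q - 1) * W y) powr (r / q)"
      using jensen(2)[OF y] rq by (intro powr_mono2) auto
    also have "\<dots> = \<kappa> powr ((q - 1) * (r / q)) * W y powr (r / q)"
      using W0[of y] by (simp add: powr_mult powr_powr)
    \<comment> \<open>One factor W is kept and the remaining power is bounded through W \<le> A; the
      estimate is then linear in W, so Tonelli's theorem applies.\<close>
    also have "\<dots> \<le> \<kappa> powr ((q - 1) * (r / q)) * (A powr (r / q - 1) * W y)"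
    proof (rule mult_left_mono)
      show "W y powr (r / q) \<le> A powr (r / q - 1) * W y"
      proof (cases "W y = 0")
        case False
        then have "W y powr (r / q) = W y powr (r / q - 1) * W y"
          using W0[of y] powr_add[of "W y" "r / q - 1" 1] by simp
        also have "\<dots> \<le> A powr (r / q - 1) * W y"
          using W0[of y] WA[OF y] rq by (intro mult_right_mono powr_mono2) auto
        finally show ?thesis .
      qed simp
    qed simp
    finally show ?thesis by (simp add: D_def)
  qed
  have m[measurable]: "\<psi> \<in> borel_measurable T" unfolding \<psi>_def by measurable
  have "(\<integral>\<^sup>+y. ennreal (\<psi> y powr r) \<partial>T) \<le>
      (\<integral>\<^sup>+y. ennreal D * (\<integral>\<^sup>+x. ennreal (K x y) * ennreal (\<phi> x powr q) \<partial>T) \<partial>T)"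
  proof (rule nn_integral_mono)
    fix y assume y: "y \<in> space T"
    have eq: "ennreal (W y) = (\<integral>\<^sup>+x. ennreal (K x y) * ennreal (\<phi> x powr q) \<partial>T)"
      unfolding W_def using K0 nn_integral_eq_integral[OF Wi[OF y]] by (simp add: ennreal_mult)
    show "ennreal (\<psi> y powr r) \<le> ennreal D * (\<integral>\<^sup>+x. ennreal (K x y) * ennreal (\<phi> x powr q) \<partial>T)"
      unfolding eq[symmetric] using pw[OF y] D0 W0[of y]
      by (simp add: ennreal_mult[symmetric] ennreal_leI)
  qed
  also have "\<dots> = ennreal D * (\<integral>\<^sup>+y. \<integral>\<^sup>+x. ennreal (K x y) * ennreal (\<phi> x powr q) \<partial>T \<partial>T)"
    by (rule nn_integral_cmult) measurable
  also have "(\<integral>\<^sup>+y. \<integral>\<^sup>+x. ennreal (K x y) * ennreal (\<phi> x powr q) \<partial>T \<partial>T) =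
      (\<integral>\<^sup>+x. \<integral>\<^sup>+y. ennreal (K x y) * ennreal (\<phi> x powr q) \<partial>T \<partial>T)"
    by (rule TT.Fubini') measurable
  also have "\<dots> \<le> (\<integral>\<^sup>+x. ennreal \<kappa> * ennreal (\<phi> x powr q) \<partial>T)"
  proof (rule nn_integral_mono)
    fix x assume x: "x \<in> space T"
    have [measurable]: "(\<lambda>y. K x y) \<in> borel_measurable T"
      using measurable_compose[OF measurable_Pair1'[OF x] K] by simp
    have "(\<integral>\<^sup>+y. ennreal (K x y) * ennreal (\<phi> x powr q) \<partial>T) = (\<integral>\<^sup>+y. ennreal (K x y) \<partial>T) * ennreal (\<phi> x powr q)"
      by (rule nn_integral_multc) measurable
    also have "\<dots> \<le> ennreal \<kappa> * ennreal (\<phi> x powr q)" by (intro mult_right_mono Ky x) simp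
    finally show "(\<integral>\<^sup>+y. ennreal (K x y) * ennreal (\<phi> x powr q) \<partial>T) \<le> ennreal \<kappa> * ennreal (\<phi> x powr q)" .
  qed
  also have "\<dots> = ennreal \<kappa> * ennreal A"
    unfolding A_def using nn_integral_eq_integral[OF \<phi>q] by (simp add: nn_integral_cmult)
  finally have "(\<integral>\<^sup>+y. ennreal (\<psi> y powr r) \<partial>T) \<le> ennreal D * (ennreal \<kappa> * ennreal A)"
    by (simp add: mult_left_mono)
  also have "\<dots> = ennreal (D * (\<kappa> * A))" using D0 \<kappa> A0 by (simp add: ennreal_mult)
  finally have bound: "(\<integral>\<^sup>+y. ennreal (\<psi> y powr r) \<partial>T) \<le> ennreal (D * (\<kappa> * A))" .
  show i: "integrable T (\<lambda>y. \<psi> y powr r)"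
    using bound by (intro integrableI_bounded) (auto simp: le_less_trans)
  have "ennreal (\<integral>y. \<psi> y powr r \<partial>T) \<le> ennreal (D * (\<kappa> * A))"
    using bound nn_integral_eq_integral[OF i] by simp
  then have "(\<integral>y. \<psi> y powr r \<partial>T) \<le> D * (\<kappa> * A)"
    using D0 \<kappa> A0 by (simp add: ennreal_le_iff)
  also have "\<dots> = \<kappa> powr ((q - 1) * (r / q) + 1) * A powr (r / q)"
  proof (cases "A = 0")
    case False
    then show ?thesis
      using \<kappa> A0 powr_add[of A "r / q - 1" 1] by (simp add: D_def powr_add mult_ac)
  qed simp
  finally show "(\<integral>y. \<psi> y powr r \<partial>T) \<le> \<kappa> powr ((q - 1) * (r / q) + 1) * A powr (r / q)" .
qed

section \<open>Sufficiency\<close>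

text \<open>Comparison with two geometric series of ratio b^(- d), one over each half-line.\<close>

lemma nn_integral_int_powr_abs_finite:
  fixes b d :: real
  assumes "1 < b" "0 < d"
  shows "(\<integral>\<^sup>+k. ennreal (b powr (- d * \<bar>of_int k\<bar>)) \<partial>count_space (UNIV :: int set)) < \<infinity>"
proof -
  define g where "g k = ennreal (b powr (- d * \<bar>of_int k\<bar>))" for k :: int
  define c where "c = b powr (- d)"
  have c: "0 \<le> c" "c < 1" using assms by (auto simp: c_def powr_less_one)
  have "g (int n) = ennreal (c ^ n)" for n
    using assms by (simp add: g_def c_def powr_powr flip: powr_realpow)
  then have "(\<integral>\<^sup>+n. g (int n) \<partial>count_space UNIV) = ennreal (\<Sum>n. c ^ n)"
    using c by (simp add: nn_integral_count_space_nat suminf_ennreal2 summable_geometric)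
  then have fin: "(\<integral>\<^sup>+n. g (int n) \<partial>count_space UNIV) < \<infinity>" by simp
  have bij: "bij_betw int UNIV {0..}" "bij_betw (\<lambda>n. - int n) UNIV {..0}"
    by (rule bij_betwI[where g = nat], auto)
       (rule bij_betwI[where g = "\<lambda>k. nat (- k)"], auto)
  \<comment> \<open>Both half-lines contain 0, whose term is counted twice; hence an inequality
    only.\<close>
  have "(\<integral>\<^sup>+k. g k \<partial>count_space UNIV) \<le>
      (\<integral>\<^sup>+k. g k * indicator {0..} k + g k * indicator {..0} k \<partial>count_space UNIV)"
    by (rule nn_integral_mono) (auto split: split_indicator)
  also have "\<dots> = (\<integral>\<^sup>+k. g k \<partial>count_space {0..}) + (\<integral>\<^sup>+k. g k \<partial>count_space {..0})"
    by (simp add: nn_integral_add nn_integral_count_space_indicator)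
  also have "(\<integral>\<^sup>+k. g k \<partial>count_space {0..}) = (\<integral>\<^sup>+n. g (int n) \<partial>count_space UNIV)"
    by (rule nn_integral_bij_count_space[OF bij(1), symmetric])
  also have "(\<integral>\<^sup>+k. g k \<partial>count_space {..0}) = (\<integral>\<^sup>+n. g (- int n) \<partial>count_space UNIV)"
    by (rule nn_integral_bij_count_space[OF bij(2), symmetric])
  also have "\<dots> = (\<integral>\<^sup>+n. g (int n) \<partial>count_space UNIV)" by (simp add: g_def)
  finally show ?thesis using fin unfolding g_def by (simp add: le_less_trans)
qed

section \<open>Size and decay of the kernel\<close>

lemma hlp_kernel_nonneg: "0 \<le> hlp_kernel l \<mu> \<nu> x (y :: 'p::prime_card padic)"
  by (simp add: hlp_kernel_def)

text \<open>Through this symmetry one marginal estimate serves for both variables.\<close>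

lemma hlp_kernel_swap: "hlp_kernel l \<mu> \<nu> x y = hlp_kernel l \<nu> \<mu> y (x :: 'p::prime_card padic)"
  by (simp add: hlp_kernel_def max.commute mult.commute)

lemma hlp_kernel_le_1:
  assumes "0 \<le> s" "0 \<le> t"
  shows "hlp_kernel (s + t) s t x (y :: 'p::prime_card padic) \<le> 1"
proof -
  let ?m = "max (padic_norm x) (padic_norm y)"
  have "padic_norm x powr s * padic_norm y powr t \<le> ?m powr s * ?m powr t"
    using assms padic_norm_nonneg[of x] padic_norm_nonneg[of y] by (intro mult_mono powr_mono2) auto
  then show ?thesis
    unfolding hlp_kernel_def powr_add by (intro divide_le_eq_1[THEN iffD2]) (auto simp: less_le)
qed

text \<open>The maximum cancels against the larger of the two powers and leaves b^(- s (j - k)) for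
  k \<le> j and b^(- t (k - j)) otherwise.\<close>

lemma powr_kernel_le:
  fixes b s t :: real and j k :: int
  assumes "1 < b" "0 < s" "0 < t"
  shows "(b powr k) powr s * (b powr j) powr t / max (b powr k) (b powr j) powr (s + t)
    \<le> b powr (- min s t * \<bar>of_int (k - j)\<bar>)"
proof (cases "k \<le> j")
  case True
  then have m: "max (b powr k) (b powr j) = b powr j" using assms by (simp add: max_def)
  have "(b powr k) powr s * (b powr j) powr t / max (b powr k) (b powr j) powr (s + t) =
      b powr (- s * of_int (j - k))"
    unfolding m using assms by (simp add: powr_powr algebra_simps flip: powr_add powr_diff)
  also have "\<dots> \<le> b powr (- min s t * \<bar>of_int (k - j)\<bar>)"
    using assms True by (intro powr_mono) (auto intro!: mult_right_mono)
  finally show ?thesis .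
next
  case False
  then have m: "max (b powr k) (b powr j) = b powr k" using assms by (simp add: max_def)
  have "(b powr k) powr s * (b powr j) powr t / max (b powr k) (b powr j) powr (s + t) =
      b powr (- t * of_int (k - j))"
    unfolding m using assms by (simp add: powr_powr algebra_simps flip: powr_add powr_diff)
  also have "\<dots> \<le> b powr (- min s t * \<bar>of_int (k - j)\<bar>)"
    using assms False by (intro powr_mono) (auto intro!: mult_right_mono)
  finally show ?thesis .
qed

context padic_haar
begin

text \<open>The density 1 / |x| cancels the factor p^k in the measure of the sphere |x| = p^k. What
  remains depends on k - j only, where |y| = p^j, so a shift of the index makes the bound
  independent of y.\<close>

lemma nn_integral_kernel_le:
  assumes "0 < s" "0 < t" "y \<in> space P"
  shows "(\<integral>\<^sup>+x. ennreal (1 / padic_norm x) * ennreal (hlp_kernel (s + t) s t x y) \<partial>P) \<le>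
    (\<integral>\<^sup>+k. ennreal (real CARD('p) powr (- min s t * \<bar>of_int k\<bar>)) \<partial>count_space (UNIV :: int set))"
proof -
  let ?p = "real CARD('p)"
  have p1: "?p > 1" by (rule prime_card_real_gt_1)
  have "y \<noteq> 0" using assms by (simp add: space_P)
  then obtain j where j: "padic_norm y = ?p powr of_int j" by (rule padic_norm_value_group)
  define g where "g u = 1 / u * (u powr s * padic_norm y powr t / max u (padic_norm y) powr (s + t))" for u
  have "(\<integral>\<^sup>+x. ennreal (1 / padic_norm x) * ennreal (hlp_kernel (s + t) s t x y) \<partial>P) =
      (\<integral>\<^sup>+x. ennreal (g (padic_norm x)) \<partial>P)"
    unfolding g_def hlp_kernel_def
    by (intro nn_integral_cong ennreal_mult[symmetric]) (auto simp: padic_norm_nonneg)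
  also have "\<dots> = (\<integral>\<^sup>+k. ennreal (g (?p powr of_int k)) * ennreal ((1 - 1 / ?p) * ?p powr of_int k) \<partial>count_space UNIV)"
    by (rule nn_integral_radial) (unfold g_def, measurable)
  also have "\<dots> \<le> (\<integral>\<^sup>+k. ennreal (?p powr (- min s t * \<bar>of_int (k - j)\<bar>)) \<partial>count_space UNIV)"
  proof (rule nn_integral_mono)
    fix k :: int
    let ?q = "(?p powr k) powr s * (?p powr j) powr t / max (?p powr k) (?p powr j) powr (s + t)"
    have "g (?p powr of_int k) * ((1 - 1 / ?p) * ?p powr of_int k) = (1 - 1 / ?p) * ?q"
      unfolding g_def j by simp
    also have "\<dots> \<le> 1 * ?q" using p1 by (intro mult_right_mono) auto
    also have "\<dots> \<le> ?p powr (- min s t * \<bar>of_int (k - j)\<bar>)"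
      using powr_kernel_le[OF p1 assms(1,2)] by simp
    finally have "g (?p powr of_int k) * ((1 - 1 / ?p) * ?p powr of_int k) \<le> ?p powr (- min s t * \<bar>of_int (k - j)\<bar>)" .
    moreover have "g (?p powr of_int k) \<ge> 0" unfolding g_def by simp
    moreover have "(1 - 1 / ?p) * ?p powr of_int k \<ge> 0" using p1 by simp
    ultimately show "ennreal (g (?p powr of_int k)) * ennreal ((1 - 1 / ?p) * ?p powr of_int k)
        \<le> ennreal (?p powr (- min s t * \<bar>of_int (k - j)\<bar>))"
      by (simp add: ennreal_mult[symmetric] ennreal_leI del: of_int_diff)
  qed
  also have "\<dots> = (\<integral>\<^sup>+k. ennreal (?p powr (- min s t * \<bar>of_int k\<bar>)) \<partial>count_space (UNIV :: int set))"
    by (rule nn_integral_bij_count_space[where g = "\<lambda>k. k - j"])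
       (auto intro!: bij_betwI[where g = "\<lambda>k. k + j"])
  finally show ?thesis .
qed

section \<open>Measurability and the multiplicative Haar measure\<close>

lemma hlp_kernel_measurable:
  "case_prod (hlp_kernel l \<mu> \<nu>) \<in> borel_measurable (P \<Otimes>\<^sub>M P)"
  unfolding hlp_kernel_def by measurable

lemma hlp_kernel_measurable1 [measurable]: "(\<lambda>x. hlp_kernel l \<mu> \<nu> x y) \<in> borel_measurable P"
  unfolding hlp_kernel_def by measurable

lemma hlp_op_measurable:
  assumes [measurable]: "f \<in> borel_measurable P"
  shows "hlp_op M l \<mu> \<nu> f \<in> borel_measurable P"
proof -
  interpret P: sigma_finite_measure P by (rule sigma_finite_P)
  show ?thesis unfolding hlp_op_def hlp_kernel_def by measurable
qed

text \<open>A Haar measure of the multiplicative group of nonzero elements; every sphere has the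
  same mass 1 - 1 / p.\<close>

definition mult_haar :: "'p padic measure" where
  "mult_haar = density P (\<lambda>x. ennreal (1 / padic_norm x))"

lemma sets_mult_haar [measurable_cong]: "sets mult_haar = sets P"
  by (simp add: mult_haar_def)

lemma space_mult_haar: "space mult_haar = space P"
  by (simp add: mult_haar_def)

lemma nn_integral_mult_haar:
  "f \<in> borel_measurable P \<Longrightarrow> (\<integral>\<^sup>+x. f x \<partial>mult_haar) = (\<integral>\<^sup>+x. ennreal (1 / padic_norm x) * f x \<partial>P)"
  unfolding mult_haar_def by (rule nn_integral_density) auto

lemma integrable_mult_haar:
  fixes f :: "'p padic \<Rightarrow> real"
  shows "f \<in> borel_measurable P \<Longrightarrow> integrable mult_haar f \<longleftrightarrow> integrable P (\<lambda>x. 1 / padic_norm x * f x)"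
  unfolding mult_haar_def by (subst integrable_density) (auto simp: padic_norm_nonneg)

lemma integral_mult_haar:
  fixes f :: "'p padic \<Rightarrow> real"
  shows "f \<in> borel_measurable P \<Longrightarrow> (\<integral>x. f x \<partial>mult_haar) = (\<integral>x. 1 / padic_norm x * f x \<partial>P)"
  unfolding mult_haar_def by (subst integral_density) (auto simp: padic_norm_nonneg)

lemma sigma_finite_mult_haar: "sigma_finite_measure mult_haar"
proof
  have fin: "emeasure mult_haar (padic_shell k) \<noteq> \<infinity>" for k
  proof -
    have "emeasure mult_haar (padic_shell k) = (\<integral>\<^sup>+x. ennreal (1 / padic_norm x) * indicator (padic_shell k) x \<partial>P)"
      unfolding mult_haar_def by (rule emeasure_density) auto
    also have "\<dots> = (\<integral>\<^sup>+x. ennreal (1 / real CARD('p) powr of_int k) * indicator (padic_shell k) x \<partial>P)"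
      by (rule nn_integral_cong) (auto simp: padic_shell_def split: split_indicator)
    also have "\<dots> < \<infinity>"
      by (simp add: nn_integral_cmult_indicator emeasure_P_shell ennreal_mult_less_top)
    finally show ?thesis by simp
  qed
  show "\<exists>A. countable A \<and> A \<subseteq> sets mult_haar \<and> \<Union> A = space mult_haar \<and> (\<forall>a\<in>A. emeasure mult_haar a \<noteq> \<infinity>)"
    by (rule exI[of _ "range padic_shell"])
       (use fin in \<open>auto simp: Union_padic_shell space_mult_haar sets_mult_haar\<close>)
qed

text \<open>With \<phi> in place of f, the source norm becomes the unweighted L^q norm over
  \<open>mult_haar\<close>. The operator becomes integration against K up to the factor |y|^(-
  (\<beta> + 1) / r), which absorbs the target weight.\<close>

lemma hlp_bounded_if:
  assumes q: "1 \<le> q" "q \<le> r"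
    and s: "s = \<mu> + 1 - (\<alpha> + 1) / q" "0 < s" and t: "t = \<nu> + (\<beta> + 1) / r" "0 < t" and l: "l = s + t"
  shows "hlp_bounded M l \<mu> \<nu> q \<alpha> r \<beta>"
proof -
  let ?K = "hlp_kernel (s + t) s t :: 'p padic \<Rightarrow> 'p padic \<Rightarrow> real"
  have r: "r > 0" using q by simp
  obtain \<kappa> where \<kappa>: "0 < \<kappa>"
    "(\<integral>\<^sup>+k. ennreal (real CARD('p) powr (- min s t * \<bar>of_int k\<bar>)) \<partial>count_space (UNIV :: int set)) \<le> ennreal \<kappa>"
  proof -
    have "(\<integral>\<^sup>+k. ennreal (real CARD('p) powr (- min s t * \<bar>of_int k\<bar>)) \<partial>count_space (UNIV :: int set)) < \<infinity>"
      using s t by (intro nn_integral_int_powr_abs_finite prime_card_real_gt_1) auto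
    then obtain c where "0 \<le> c"
      "(\<integral>\<^sup>+k. ennreal (real CARD('p) powr (- min s t * \<bar>of_int k\<bar>)) \<partial>count_space (UNIV :: int set)) = ennreal c"
      by (auto simp: less_top_ennreal)
    \<comment> \<open>Adding 1 makes \<kappa> strictly positive even if c = 0.\<close>
    then show thesis using that[of "c + 1"] by (simp add: ennreal_leI)
  qed
  have Kx: "(\<integral>\<^sup>+x. ennreal (?K x y) \<partial>mult_haar) \<le> ennreal \<kappa>" if "y \<in> space mult_haar" for y
    using nn_integral_kernel_le[OF s(2) t(2), of y] \<kappa>(2) that
    by (simp add: nn_integral_mult_haar space_mult_haar)
  have Ky: "(\<integral>\<^sup>+y. ennreal (?K x y) \<partial>mult_haar) \<le> ennreal \<kappa>" if "x \<in> space mult_haar" for x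
    using nn_integral_kernel_le[OF t(2) s(2), of x] \<kappa>(2) that
    by (simp add: nn_integral_mult_haar space_mult_haar hlp_kernel_swap[of _ s t] add.commute min.commute)
  have Km: "case_prod ?K \<in> borel_measurable (mult_haar \<Otimes>\<^sub>M mult_haar)"
    using hlp_kernel_measurable by (simp add: measurable_cong_sets[OF sets_pair_measure_cong[OF sets_mult_haar sets_mult_haar] refl])
  \<comment> \<open>The r-th root of the constant in \<open>bounded_kernel_Lq_Lr\<close>.\<close>
  define C where "C = (\<kappa> powr ((q - 1) * (r / q) + 1)) powr (1 / r)"
  \<comment> \<open>Absolute convergence is obtained at every nonzero y, not only almost
    everywhere.\<close>
  have main: "(\<forall>y\<in>space P. integrable P (\<lambda>x. hlp_kernel l \<mu> \<nu> x y * f x)) \<and>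
      hlp_op M l \<mu> \<nu> f \<in> Lspace M r \<beta> \<and> Lnorm M r \<beta> (hlp_op M l \<mu> \<nu> f) \<le> C * Lnorm M q \<alpha> f"
    if f: "f \<in> Lspace M q \<alpha>" for f
  proof -
    have fm [measurable]: "f \<in> borel_measurable P"
      and fi: "integrable P (\<lambda>x. \<bar>f x\<bar> powr q * padic_norm x powr \<alpha>)"
      using f by (auto simp: Lspace_def)
    define \<phi> where "\<phi> x = \<bar>f x\<bar> * padic_norm x powr ((\<alpha> + 1) / q)" for x
    have \<phi>m [measurable]: "\<phi> \<in> borel_measurable P" unfolding \<phi>_def by measurable
    have \<phi>0: "\<phi> x \<ge> 0" for x unfolding \<phi>_def by simp
    have pos: "padic_norm x > 0" if "x \<in> space P" for x :: "'p padic"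
      using that padic_norm_pos by (simp add: space_P)
    have \<phi>eq: "1 / padic_norm x * \<phi> x powr q = \<bar>f x\<bar> powr q * padic_norm x powr \<alpha>" if "x \<in> space P" for x
    proof -
      have "padic_norm x powr (\<alpha> + 1) = padic_norm x powr \<alpha> * padic_norm x"
        using pos[OF that] by (simp add: powr_add)
      then show ?thesis
        unfolding \<phi>_def using pos[OF that] q by (simp add: powr_mult powr_powr)
    qed
    have \<phi>i: "integrable mult_haar (\<lambda>x. \<phi> x powr q)"
      by (subst integrable_mult_haar)
         (use fi \<phi>eq in \<open>auto simp: cong: Bochner_Integration.integrable_cong\<close>)
    define A where "A = (\<integral>x. \<bar>f x\<bar> powr q * padic_norm x powr \<alpha> \<partial>P)"
    have A0: "A \<ge> 0" unfolding A_def by simp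
    have \<phi>A: "(\<integral>x. \<phi> x powr q \<partial>mult_haar) = A"
      unfolding A_def
      by (subst integral_mult_haar) (use \<phi>eq in \<open>auto intro!: Bochner_Integration.integral_cong\<close>)
    define \<psi> where "\<psi> y = (\<integral>x. ?K x y * \<phi> x \<partial>mult_haar)" for y
    have \<phi>m': "\<phi> \<in> borel_measurable mult_haar" by measurable
    note Lqr = bounded_kernel_Lq_Lr[OF sigma_finite_mult_haar Km hlp_kernel_nonneg
        hlp_kernel_le_1[OF less_imp_le[OF s(2)] less_imp_le[OF t(2)]] Kx Ky \<kappa>(1) q \<phi>m' \<phi>0 \<phi>i]
    \<comment> \<open>By the choice of s and t, |x|^\<mu> = |x|^(- 1) |x|^s |x|^((\<alpha> + 1) / q)
      and |y|^\<nu> = |y|^(- (\<beta> + 1) / r) |y|^t: the density of \<open>mult_haar\<close>, the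
      kernel K, the weight inside \<phi> and the outer factor.\<close>
    have keq: "hlp_kernel l \<mu> \<nu> x y * \<bar>f x\<bar> =
        padic_norm y powr (- ((\<beta> + 1) / r)) * (1 / padic_norm x * (?K x y * \<phi> x))"
      if x: "x \<in> space P" and y: "y \<in> space P" for x y
    proof -
      have "padic_norm x powr \<mu> = 1 / padic_norm x * (padic_norm x powr s * padic_norm x powr ((\<alpha> + 1) / q))"
        using pos[OF x] by (simp add: s(1) powr_add powr_diff)
      moreover have "padic_norm y powr \<nu> = padic_norm y powr (- ((\<beta> + 1) / r)) * padic_norm y powr t"
        using pos[OF y] by (simp add: t(1) flip: powr_add)
      ultimately show ?thesis unfolding hlp_kernel_def \<phi>_def l by simp
    qed
    have iabs: "integrable P (\<lambda>x. hlp_kernel l \<mu> \<nu> x y * \<bar>f x\<bar>)"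
      and eabs: "(\<integral>x. hlp_kernel l \<mu> \<nu> x y * \<bar>f x\<bar> \<partial>P) = padic_norm y powr (- ((\<beta> + 1) / r)) * \<psi> y"
      if y: "y \<in> space P" for y
    proof -
      have "integrable mult_haar (\<lambda>x. ?K x y * \<phi> x)" using Lqr(1) y by (simp add: space_mult_haar)
      then have i: "integrable P (\<lambda>x. 1 / padic_norm x * (?K x y * \<phi> x))"
        by (subst (asm) integrable_mult_haar) auto
      show "integrable P (\<lambda>x. hlp_kernel l \<mu> \<nu> x y * \<bar>f x\<bar>)"
        using integrable_mult_right[OF i, of "padic_norm y powr (- ((\<beta> + 1) / r))"] keq[OF _ y]
        by (simp cong: Bochner_Integration.integrable_cong)
      have "(\<integral>x. hlp_kernel l \<mu> \<nu> x y * \<bar>f x\<bar> \<partial>P) =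
          (\<integral>x. padic_norm y powr (- ((\<beta> + 1) / r)) * (1 / padic_norm x * (?K x y * \<phi> x)) \<partial>P)"
        using keq[OF _ y] by (intro Bochner_Integration.integral_cong) auto
      also have "\<dots> = padic_norm y powr (- ((\<beta> + 1) / r)) * \<psi> y"
        unfolding \<psi>_def by (subst integral_mult_haar, measurable) (rule integral_mult_right_zero)
      finally show "(\<integral>x. hlp_kernel l \<mu> \<nu> x y * \<bar>f x\<bar> \<partial>P) = padic_norm y powr (- ((\<beta> + 1) / r)) * \<psi> y" .
    qed
    have int: "integrable P (\<lambda>x. hlp_kernel l \<mu> \<nu> x y * f x)" if y: "y \<in> space P" for y
      by (rule Bochner_Integration.integrable_bound[OF iabs[OF y]])
         (auto simp: abs_mult hlp_kernel_nonneg)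
    let ?H = "hlp_op M l \<mu> \<nu> f"
    have Hm [measurable]: "?H \<in> borel_measurable P" by (rule hlp_op_measurable) measurable
    have \<psi>0: "\<psi> y \<ge> 0" for y unfolding \<psi>_def
      by (intro integral_nonneg_AE AE_I2 mult_nonneg_nonneg \<phi>0 hlp_kernel_nonneg)
    \<comment> \<open>The r-th power of the outer factor is |y|^(- (\<beta> + 1)), which together
      with the weight |y|^\<beta> is again the density 1 / |y|.\<close>
    have Hle: "\<bar>?H y\<bar> powr r * padic_norm y powr \<beta> \<le> 1 / padic_norm y * \<psi> y powr r" if y: "y \<in> space P" for y
    proof -
      have "\<bar>?H y\<bar> \<le> (\<integral>x. \<bar>hlp_kernel l \<mu> \<nu> x y * f x\<bar> \<partial>P)"
        unfolding hlp_op_def by (rule integral_abs_bound)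
      also have "\<dots> = padic_norm y powr (- ((\<beta> + 1) / r)) * \<psi> y"
        using eabs[OF y] by (simp add: abs_mult hlp_kernel_nonneg)
      finally have "\<bar>?H y\<bar> powr r \<le> (padic_norm y powr (- ((\<beta> + 1) / r)) * \<psi> y) powr r"
        using r by (intro powr_mono2) auto
      also have "\<dots> = padic_norm y powr (- (\<beta> + 1)) * \<psi> y powr r"
        using r \<psi>0 by (simp add: powr_mult powr_powr)
      finally have "\<bar>?H y\<bar> powr r * padic_norm y powr \<beta> \<le> padic_norm y powr (- (\<beta> + 1)) * \<psi> y powr r * padic_norm y powr \<beta>"
        by (rule mult_right_mono) simp
      also have "\<dots> = (padic_norm y powr (- (\<beta> + 1)) * padic_norm y powr \<beta>) * \<psi> y powr r"
        by simp
      also have "padic_norm y powr (- (\<beta> + 1)) * padic_norm y powr \<beta> = 1 / padic_norm y"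
        using pos[OF y] by (simp add: powr_minus_divide flip: powr_add)
      finally show ?thesis .
    qed
    have \<psi>int: "integrable mult_haar (\<lambda>y. \<psi> y powr r)"
      and \<psi>le: "(\<integral>y. \<psi> y powr r \<partial>mult_haar) \<le> \<kappa> powr ((q - 1) * (r / q) + 1) * A powr (r / q)"
      using Lqr(2,3) unfolding \<psi>_def \<phi>A by auto
    have \<psi>m [measurable]: "(\<lambda>y. \<psi> y powr r) \<in> borel_measurable P"
      using borel_measurable_integrable[OF \<psi>int] by (simp add: measurable_cong_sets[OF sets_mult_haar refl])
    have \<psi>i: "integrable P (\<lambda>y. 1 / padic_norm y * \<psi> y powr r)"
      using \<psi>int by (subst (asm) integrable_mult_haar) auto
    have Hi: "integrable P (\<lambda>y. \<bar>?H y\<bar> powr r * padic_norm y powr \<beta>)"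
      by (rule Bochner_Integration.integrable_bound[OF \<psi>i])
         (use Hle in \<open>auto intro!: AE_I2 simp: abs_of_nonneg[OF padic_norm_nonneg]\<close>)
    have "(\<integral>y. \<bar>?H y\<bar> powr r * padic_norm y powr \<beta> \<partial>P) \<le> (\<integral>y. 1 / padic_norm y * \<psi> y powr r \<partial>P)"
      by (rule integral_mono[OF Hi \<psi>i Hle])
    also have "\<dots> = (\<integral>y. \<psi> y powr r \<partial>mult_haar)" by (rule integral_mult_haar[symmetric]) measurable
    finally have "(\<integral>y. \<bar>?H y\<bar> powr r * padic_norm y powr \<beta> \<partial>P) \<le> \<kappa> powr ((q - 1) * (r / q) + 1) * A powr (r / q)"
      using \<psi>le by simp
    then have "Lnorm M r \<beta> ?H \<le> (\<kappa> powr ((q - 1) * (r / q) + 1) * A powr (r / q)) powr (1 / r)"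
      unfolding Lnorm_def using r by (intro powr_mono2) auto
    also have "\<dots> = C * A powr (1 / q)"
      unfolding C_def using r q by (simp add: powr_mult powr_powr)
    also have "\<dots> = C * Lnorm M q \<alpha> f" by (simp add: Lnorm_def A_def)
    finally show ?thesis using int Hi Hm by (auto simp: Lspace_def)
  qed
  show ?thesis
    unfolding hlp_bounded_def
  proof (intro conjI ballI exI[of _ C])
    fix f assume "f \<in> Lspace M q \<alpha>"
    from main[OF this] show "AE y in P. integrable P (\<lambda>x. hlp_kernel l \<mu> \<nu> x y * f x)"
      "hlp_op M l \<mu> \<nu> f \<in> Lspace M r \<beta>" "Lnorm M r \<beta> (hlp_op M l \<mu> \<nu> f) \<le> C * Lnorm M q \<alpha> f"
      by (auto intro: AE_I2)
  qed
qed

end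

section \<open>Necessity\<close>

text \<open>If E were nonzero, taking k of the same sign as E would give arbitrarily large powers of
  b^|E|.\<close>

lemma powr_int_bounded_imp_zero:
  fixes b E B :: real
  assumes "1 < b" and bound: "\<And>k :: int. b powr (of_int k * E) \<le> B"
  shows "E = 0"
proof (rule ccontr)
  assume "E \<noteq> 0"
  then have "1 < b powr \<bar>E\<bar>" using assms(1) by simp
  then obtain n where n: "B < (b powr \<bar>E\<bar>) ^ n" using real_arch_pow by blast
  define k :: int where "k = (if E > 0 then int n else - int n)"
  have "(b powr \<bar>E\<bar>) ^ n = b powr (of_int k * E)"
    using assms(1) by (simp add: k_def powr_powr mult.commute flip: powr_realpow)
  then show False using n bound[of k] by simp
qed

context padic_haar
begin

section \<open>Test functions: indicators of spheres\<close>

lemma integral_padic_shell: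
  "integrable P (\<lambda>x. c * indicat_real (padic_shell k) x)"
  "(\<integral>x. c * indicat_real (padic_shell k) x \<partial>P) = c * ((1 - 1 / real CARD('p)) * real CARD('p) powr of_int k)"
proof -
  have p1: "real CARD('p) > 1" by (rule prime_card_real_gt_1)
  have m: "measure P (padic_shell k) = (1 - 1 / real CARD('p)) * real CARD('p) powr of_int k"
    unfolding measure_def emeasure_P_shell using p1 by (intro enn2real_ennreal) simp
  have "emeasure P (padic_shell k) < \<infinity>" by (simp add: emeasure_P_shell)
  then show "integrable P (\<lambda>x. c * indicat_real (padic_shell k) x)"
    by (intro integrable_mult_right integrable_real_indicator) auto
  show "(\<integral>x. c * indicat_real (padic_shell k) x \<partial>P) = c * ((1 - 1 / real CARD('p)) * real CARD('p) powr of_int k)"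
    by (simp add: m[symmetric])
qed

lemma hlp_op_padic_shell:
  "hlp_op M l \<mu> \<nu> (indicat_real (padic_shell k)) y =
     (real CARD('p) powr of_int k) powr \<mu> * padic_norm y powr \<nu> /
       max (real CARD('p) powr of_int k) (padic_norm y) powr l *
     ((1 - 1 / real CARD('p)) * real CARD('p) powr of_int k)"
  unfolding hlp_op_def integral_padic_shell(2)[symmetric]
  by (rule Bochner_Integration.integral_cong)
     (auto simp: hlp_kernel_def padic_shell_def split: split_indicator)

lemma padic_shell_Lspace:
  "indicat_real (padic_shell k) \<in> Lspace M q \<alpha>"
  "Lnorm M q \<alpha> (indicat_real (padic_shell k)) =
     ((real CARD('p) powr of_int k) powr \<alpha> * ((1 - 1 / real CARD('p)) * real CARD('p) powr of_int k)) powr (1 / q)"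
proof -
  \<comment> \<open>Off the sphere both sides vanish, as \<open>0 powr q = 0\<close> for every
    q.\<close>
  have eq: "\<bar>indicat_real (padic_shell k) x\<bar> powr q * padic_norm x powr \<alpha> =
      (real CARD('p) powr of_int k) powr \<alpha> * indicat_real (padic_shell k) x" for x :: "'p padic"
    by (auto simp: padic_shell_def split: split_indicator)
  show "indicat_real (padic_shell k) \<in> Lspace M q \<alpha>"
    unfolding Lspace_def mem_Collect_eq eq by (intro conjI integral_padic_shell(1)) measurable
  show "Lnorm M q \<alpha> (indicat_real (padic_shell k)) =
     ((real CARD('p) powr of_int k) powr \<alpha> * ((1 - 1 / real CARD('p)) * real CARD('p) powr of_int k)) powr (1 / q)"
    unfolding Lnorm_def eq integral_padic_shell(2) ..
qed

text \<open>On the indicator of the sphere of radius u = p^k, both sides of the norm inequality are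
  compared as powers of u. The exponents differ by E, so u^E stays bounded for all integers k, which
  forces E = 0.\<close>

lemma hlp_bounded_scaling:
  assumes q: "1 \<le> q" "q \<le> r" and bdd: "hlp_bounded M l \<mu> \<nu> q \<alpha> r \<beta>"
  shows "l = \<mu> + \<nu> + 1 + (\<beta> + 1) / r - (\<alpha> + 1) / q"
proof -
  let ?p = "real CARD('p)"
  define c where "c = 1 - 1 / ?p"
  define E where "E = \<mu> + \<nu> + 1 + (\<beta> + 1) / r - (\<alpha> + 1) / q - l"
  have p1: "?p > 1" by (rule prime_card_real_gt_1)
  then have c: "c > 0" by (simp add: c_def)
  have r: "r > 0" "q > 0" using q by auto
  obtain C where C: "\<And>f. f \<in> Lspace M q \<alpha> \<Longrightarrow> hlp_op M l \<mu> \<nu> f \<in> Lspace M r \<beta> \<and>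
        Lnorm M r \<beta> (hlp_op M l \<mu> \<nu> f) \<le> C * Lnorm M q \<alpha> f"
    using bdd unfolding hlp_bounded_def by blast
  have "?p powr (of_int k * E) \<le> C * c powr (1 / q) / (c * c powr (1 / r))" for k :: int
  proof -
    let ?f = "indicat_real (padic_shell k) :: 'p padic \<Rightarrow> real"
    define H where "H = hlp_op M l \<mu> \<nu> ?f"
    define u where "u = ?p powr of_int k"
    have u: "u > 0" using p1 by (simp add: u_def)
    \<comment> \<open>The value of the image on the sphere itself, where the maximum in the kernel
      is u. Discarding all other spheres gives a lower bound for the target norm with the right
      power of u.\<close>
    define a where "a = u powr \<mu> * u powr \<nu> / u powr l * (c * u)"
    have a: "a = c * u powr (\<mu> + \<nu> + 1 - l)"
      using u by (simp add: a_def powr_add powr_diff)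
    have Hi: "integrable P (\<lambda>y. \<bar>H y\<bar> powr r * padic_norm y powr \<beta>)"
      and Hn: "Lnorm M r \<beta> H \<le> C * Lnorm M q \<alpha> ?f"
      using C[OF padic_shell_Lspace(1)] unfolding H_def by (auto simp: Lspace_def)
    have "a powr r * u powr \<beta> * (c * u) = (\<integral>y. a powr r * u powr \<beta> * indicat_real (padic_shell k) y \<partial>P)"
      unfolding integral_padic_shell(2) by (simp add: c_def u_def)
    also have "\<dots> \<le> (\<integral>y. \<bar>H y\<bar> powr r * padic_norm y powr \<beta> \<partial>P)"
    proof (rule integral_mono[OF integral_padic_shell(1) Hi])
      fix y :: "'p padic"
      show "a powr r * u powr \<beta> * indicat_real (padic_shell k) y \<le> \<bar>H y\<bar> powr r * padic_norm y powr \<beta>"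
      proof (cases "y \<in> padic_shell k")
        case True
        then have "padic_norm y = u" by (simp add: padic_shell_def u_def)
        then have "H y = a"
          unfolding H_def hlp_op_padic_shell a_def c_def by (simp add: u_def)
        moreover have "a \<ge> 0" using a c by simp
        ultimately show ?thesis using \<open>padic_norm y = u\<close> True by simp
      qed simp
    qed
    finally have "(a powr r * u powr \<beta> * (c * u)) powr (1 / r) \<le> Lnorm M r \<beta> H"
      unfolding Lnorm_def using r u c by (intro powr_mono2) auto
    also have "(a powr r * u powr \<beta> * (c * u)) powr (1 / r) =
        c * c powr (1 / r) * u powr (\<mu> + \<nu> + 1 - l + (\<beta> + 1) / r)"
    proof -
      have eq: "a powr r * u powr \<beta> * (c * u) = (a powr r * c) * u powr (\<beta> + 1)"
        using u by (simp add: powr_add)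
      have "(a powr r * u powr \<beta> * (c * u)) powr (1 / r) = a * c powr (1 / r) * u powr ((\<beta> + 1) / r)"
        unfolding eq using r u c a by (simp add: powr_mult powr_powr)
      then show ?thesis unfolding a using u by (simp add: powr_add)
    qed
    also note Hn
    also have "Lnorm M q \<alpha> ?f = c powr (1 / q) * u powr ((\<alpha> + 1) / q)"
    proof -
      have eq: "u powr \<alpha> * (c * u) = c * u powr (\<alpha> + 1)" using u by (simp add: powr_add)
      show ?thesis
        unfolding padic_shell_Lspace(2) c_def[symmetric] u_def[symmetric] eq
        using u c r by (simp add: powr_mult powr_powr)
    qed
    finally have *: "c * c powr (1 / r) * u powr (\<mu> + \<nu> + 1 - l + (\<beta> + 1) / r) \<le>
        C * (c powr (1 / q) * u powr ((\<alpha> + 1) / q))" .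
    have "u powr (\<mu> + \<nu> + 1 - l + (\<beta> + 1) / r) = u powr E * u powr ((\<alpha> + 1) / q)"
      unfolding E_def powr_add[symmetric] by (simp add: algebra_simps)
    then have "(c * c powr (1 / r) * u powr E) * u powr ((\<alpha> + 1) / q) \<le> (C * c powr (1 / q)) * u powr ((\<alpha> + 1) / q)"
      using * by (simp add: mult_ac)
    then have "c * c powr (1 / r) * u powr E \<le> C * c powr (1 / q)"
      using u by (simp add: mult_le_cancel_right)
    then show ?thesis
      using c p1 by (simp add: u_def powr_powr field_simps)
  qed
  then have "E = 0" by (rule powr_int_bounded_imp_zero[OF p1])
  then show ?thesis by (simp add: E_def)
qed

text \<open>The image of the indicator of the unit sphere is radial. Up to one common constant, the
  sphere of radius p^k contributes p^(k (r \<nu> + \<beta> + 1)) for k \<le> 0 and p^(k (r (\<nu> -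
  l) + \<beta> + 1)) for k \<ge> 0, so finiteness requires decay at both ends.\<close>

lemma hlp_bounded_strict:
  assumes q: "1 \<le> q" "q \<le> r" and bdd: "hlp_bounded M l \<mu> \<nu> q \<alpha> r \<beta>"
  shows "0 < r * \<nu> + \<beta> + 1" "r * (\<nu> - l) + \<beta> + 1 < 0"
proof -
  let ?p = "real CARD('p)"
  define c where "c = 1 - 1 / ?p"
  have p1: "?p > 1" by (rule prime_card_real_gt_1)
  then have c: "c > 0" by (simp add: c_def)
  have r: "r > 0" using q by auto
  define h where "h u = (u powr \<nu> / max 1 u powr l * c) powr r * u powr \<beta>" for u
  define H where "H = hlp_op M l \<mu> \<nu> (indicat_real (padic_shell 0))"
  have Hh: "\<bar>H y\<bar> powr r * padic_norm y powr \<beta> = h (padic_norm y)" for y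
    unfolding H_def hlp_op_padic_shell h_def using c by (simp add: c_def[symmetric])
  have "integrable P (\<lambda>y. \<bar>H y\<bar> powr r * padic_norm y powr \<beta>)"
    using bdd padic_shell_Lspace(1)[of 0] unfolding hlp_bounded_def H_def by (auto simp: Lspace_def)
  then have "(\<integral>\<^sup>+y. ennreal (h (padic_norm y)) \<partial>P) < \<infinity>"
    unfolding Hh by (auto simp: integrable_iff_bounded h_def)
  also have "(\<integral>\<^sup>+y. ennreal (h (padic_norm y)) \<partial>P) =
      (\<integral>\<^sup>+k. ennreal (h (?p powr of_int k)) * ennreal ((1 - 1 / ?p) * ?p powr of_int k) \<partial>count_space UNIV)"
    by (rule nn_integral_radial) (unfold h_def, measurable)
  finally have fin: "(\<integral>\<^sup>+k. ennreal (h (?p powr of_int k)) * ennreal ((1 - 1 / ?p) * ?p powr of_int k) \<partial>count_space UNIV) < \<infinity>" .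
  \<comment> \<open>The threshold is the term at k = 0; a finite sum has only finitely many terms of
    at least that size.\<close>
  have finite_J: "finite J"
    if J: "\<And>k. k \<in> J \<Longrightarrow> c powr r * c \<le> h (?p powr of_int k) * (c * ?p powr of_int k)" for J :: "int set"
  proof (rule ccontr)
    assume inf: "infinite J"
    have "\<infinity> = ennreal (c powr r * c) * emeasure (count_space UNIV) J"
      using inf c by (simp add: ennreal_mult_top ennreal_eq_0_iff not_le)
    also have "\<dots> = (\<integral>\<^sup>+k. ennreal (c powr r * c) * indicator J k \<partial>count_space UNIV)"
      by (rule nn_integral_cmult_indicator[symmetric]) simp
    also have "\<dots> \<le> (\<integral>\<^sup>+k. ennreal (h (?p powr of_int k)) * ennreal ((1 - 1 / ?p) * ?p powr of_int k) \<partial>count_space UNIV)"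
    proof (rule nn_integral_mono)
      fix k :: int
      have "0 \<le> h (?p powr of_int k)" "0 \<le> c * ?p powr of_int k" using c by (auto simp: h_def)
      then show "ennreal (c powr r * c) * indicator J k \<le>
          ennreal (h (?p powr of_int k)) * ennreal ((1 - 1 / ?p) * ?p powr of_int k)"
        using J[of k] unfolding c_def[symmetric]
        by (auto simp: ennreal_mult[symmetric] intro!: ennreal_leI split: split_indicator)
    qed
    also note fin
    finally show False by simp
  qed
  show "0 < r * \<nu> + \<beta> + 1"
  proof (rule ccontr)
    assume neg: "\<not> 0 < r * \<nu> + \<beta> + 1"
    \<comment> \<open>With a nonpositive exponent no term with k \<le> 0 falls below the one at
      0.\<close>
    have "finite {..0 :: int}"
    proof (rule finite_J)
      fix k :: int assume "k \<in> {..0}"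
      then have k: "real_of_int k \<le> 0" by simp
      define u where "u = ?p powr of_int k"
      have u: "u > 0" "max 1 u = 1" using p1 k powr_mono[of "of_int k" 0 ?p] by (auto simp: u_def)
      have "h u * (c * u) = c powr r * c * u powr (r * \<nu> + \<beta> + 1)"
        unfolding h_def u(2) using u(1) c by (simp add: powr_mult powr_powr powr_add mult_ac)
      moreover have "1 \<le> u powr (r * \<nu> + \<beta> + 1)"
        unfolding u_def powr_powr using p1 k neg by (intro ge_one_powr_ge_zero mult_nonpos_nonpos) auto
      ultimately show "c powr r * c \<le> h (?p powr of_int k) * (c * ?p powr of_int k)"
        unfolding u_def[symmetric] using c by simp
    qed
    then show False by (simp add: infinite_Iic)
  qed
  show "r * (\<nu> - l) + \<beta> + 1 < 0"
  proof (rule ccontr)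
    assume neg: "\<not> r * (\<nu> - l) + \<beta> + 1 < 0"
    \<comment> \<open>The mirror image: a nonnegative exponent keeps all terms with k \<ge> 0 above
      the threshold.\<close>
    have "finite {0 :: int..}"
    proof (rule finite_J)
      fix k :: int assume "k \<in> {0..}"
      then have k: "real_of_int k \<ge> 0" by simp
      define u where "u = ?p powr of_int k"
      have u: "u > 0" "max 1 u = u" using p1 k by (auto simp: u_def ge_one_powr_ge_zero)
      have "u powr \<nu> / u powr l = u powr (\<nu> - l)" by (simp add: powr_diff)
      then have "h u * (c * u) = c powr r * c * u powr (r * (\<nu> - l) + \<beta> + 1)"
        unfolding h_def u(2) using u(1) c by (simp add: powr_mult powr_powr powr_add mult_ac)
      moreover have "1 \<le> u powr (r * (\<nu> - l) + \<beta> + 1)"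
        unfolding u_def powr_powr using p1 k neg by (intro ge_one_powr_ge_zero mult_nonneg_nonneg) auto
      ultimately show "c powr r * c \<le> h (?p powr of_int k) * (c * ?p powr of_int k)"
        unfolding u_def[symmetric] using c by simp
    qed
    then show False by (simp add: infinite_Ici)
  qed
qed

text \<open>Given l = s + t, the lower bound on \<beta> + 1 says t > 0 and the upper bound says t <
  l, that is, s > 0.\<close>

lemma hlp_bounded_iff:
  assumes q: "1 \<le> q" "q \<le> r"
  shows "hlp_bounded M l \<mu> \<nu> q \<alpha> r \<beta> \<longleftrightarrow>
    l = \<mu> + \<nu> + 1 + (\<beta> + 1) / r - (\<alpha> + 1) / q \<and> - r * \<nu> < \<beta> + 1 \<and> \<beta> + 1 < r * (l - \<nu>)"
    (is "_ \<longleftrightarrow> ?l \<and> ?lower \<and> ?upper")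
proof (intro iffI conjI)
  assume b: "hlp_bounded M l \<mu> \<nu> q \<alpha> r \<beta>"
  show ?l by (rule hlp_bounded_scaling[OF q b])
  show ?lower ?upper using hlp_bounded_strict[OF q b] by (simp_all add: algebra_simps)
next
  assume *: "?l \<and> ?lower \<and> ?upper"
  have r: "r > 0" using q by simp
  have "- \<nu> < (\<beta> + 1) / r" "(\<beta> + 1) / r < l - \<nu>"
    using * r by (simp_all add: field_simps)
  then show "hlp_bounded M l \<mu> \<nu> q \<alpha> r \<beta>"
    using * by (intro hlp_bounded_if[OF q refl _ refl]) auto
qed

end

theorem theorem1p3:
  fixes M :: "'p::prime_card padic measure"
    and q r l \<mu> \<nu> \<alpha> \<beta> :: real
  assumes "normalized_haar M" and "1 \<le> q" and "q \<le> r"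
  shows "(hlp_bounded M l \<mu> \<nu> q \<alpha> r \<beta> \<longleftrightarrow>
            l = \<mu> + \<nu> + 1 + (\<beta> + 1) / r - (\<alpha> + 1) / q \<and>
            - r * \<nu> < \<beta> + 1 \<and> \<beta> + 1 < r * (l - \<nu>)) \<and>
         (hlp_bounded M l \<mu> \<nu> q \<alpha> r \<beta> \<longleftrightarrow>
            l = \<mu> + \<nu> + 1 + (\<beta> + 1) / r - (\<alpha> + 1) / q \<and>
            q * (\<mu> + 1 - l) < \<alpha> + 1 \<and> \<alpha> + 1 < q * (\<mu> + 1))"
proof -
  interpret padic_haar M by unfold_locales (rule assms(1))
  have pos: "q > 0" "r > 0" using assms by auto
  \<comment> \<open>After division by r and q, the equation for l matches the pairs crosswise by
    position in the kernel: the lower bounds on \<beta> + 1 and \<alpha> + 1 both say t > 0, the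
    upper bounds both say s > 0.\<close>
  have "- r * \<nu> < \<beta> + 1 \<longleftrightarrow> - \<nu> < (\<beta> + 1) / r" "\<beta> + 1 < r * (l - \<nu>) \<longleftrightarrow> (\<beta> + 1) / r < l - \<nu>"
    "q * (\<mu> + 1 - l) < \<alpha> + 1 \<longleftrightarrow> \<mu> + 1 - l < (\<alpha> + 1) / q" "\<alpha> + 1 < q * (\<mu> + 1) \<longleftrightarrow> (\<alpha> + 1) / q < \<mu> + 1"
    using pos by (simp_all add: field_simps)
  then show ?thesis
    unfolding hlp_bounded_iff[OF assms(2,3)] by auto
qed

end
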